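(* Let $N$ be an integer with $|N|\ge 2$, let $G = BS(1,N) = \langle a,t \mid tat^{-1}=a^N\rangle$, and let $A \lhd G$ be the normal closure in $G$ of the subgroup $\langle a\rangle$. Then for every finite generating set $Y$ of $G$, the subset $A$ is exponentially negligible in $G$ with respect to $Y$.
   Context: For a finite generating set $Y$ of a group $G$, let $|g|_Y$ be the minimal length of a word in the elements of $Y$ and their inverses representing $g\in G$, and for $n \in \mathbb{Z}_{\ge 0}$ let $B_Y(n)=\{g\in G \mid |g|_Y\le n\}$. A subset $\mathcal{A}\subseteq G$ is exponentially negligible in $G$ with respect to $Y$ if $$\limsup_{n\to\infty}\sqrt[n]{\frac{|\mathcal{A}\cap B_Y(n)|}{|B_Y(n)|}}<1.$$ The subgroup $\langle a\rangle$ of $BS(1,N)$ is called the horocyclic subgroup. *)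

theory Defs
  imports Complex_Main "HOL-Library.Extended_Real" "HOL-Algebra.Generated_Groups"
begin

section \<open>Groups given by generators and relations\<close>

text \<open>A letter \<open>(x, True)\<close> stands for the generator \<open>x\<close>, and \<open>(x, False)\<close> for its formal inverse.\<close>

type_synonym 'x word = "('x \<times> bool) list"

text \<open>A pair \<open>(r, s)\<close> in \<open>R\<close> is the defining relation \<open>r = s\<close>.\<close>

inductive pres_eq :: "('x word \<times> 'x word) set \<Rightarrow> 'x word \<Rightarrow> 'x word \<Rightarrow> bool" for R where
  refl: "pres_eq R u u"
| sym: "pres_eq R u v \<Longrightarrow> pres_eq R v u"
| trans: "pres_eq R u v \<Longrightarrow> pres_eq R v w \<Longrightarrow> pres_eq R u w"
| cancel: "pres_eq R (u @ [(x, b), (x, \<not> b)] @ v) (u @ v)"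
| relation: "(r, s) \<in> R \<Longrightarrow> pres_eq R (u @ r @ v) (u @ s @ v)"

definition word_class :: "('x word \<times> 'x word) set \<Rightarrow> 'x word \<Rightarrow> 'x word set"
  where "word_class R w = {w'. pres_eq R w w'}"

text \<open>All elements of the type \<open>'x\<close> are generators.\<close>

definition presented_group :: "('x word \<times> 'x word) set \<Rightarrow> 'x word set monoid"
  where "presented_group R =
    \<lparr>carrier = range (word_class R),
     mult = (\<lambda>X Z. \<Union>u\<in>X. \<Union>v\<in>Z. word_class R (u @ v)),
     one = word_class R []\<rparr>"

lemma word_class_eq_iff: "word_class R u = word_class R v \<longleftrightarrow> pres_eq R u v"
proof
  assume "word_class R u = word_class R v"
  then have "v \<in> word_class R u"
    by (simp add: word_class_def pres_eq.refl)
  then show "pres_eq R u v"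
    by (simp add: word_class_def)
next
  assume uv: "pres_eq R u v"
  have "pres_eq R u w \<longleftrightarrow> pres_eq R v w" for w
    using pres_eq.trans[OF uv] pres_eq.trans[OF pres_eq.sym[OF uv]] by iprover
  then show "word_class R u = word_class R v"
    by (simp add: word_class_def)
qed

lemma pres_eq_append_left: "pres_eq R u v \<Longrightarrow> pres_eq R (w @ u) (w @ v)"
proof (induction rule: pres_eq.induct)
  case (cancel u x b v)
  then show ?case using pres_eq.cancel[of R "w @ u" x b v] by simp
next
  case (relation r s u v)
  then show ?case using pres_eq.relation[of r s R "w @ u" v] by simp
next
  case (trans u v v')
  show ?case by (rule pres_eq.trans) fact+
qed (rule pres_eq.refl, rule pres_eq.sym)

lemma pres_eq_append_right: "pres_eq R u v \<Longrightarrow> pres_eq R (u @ w) (v @ w)"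
proof (induction rule: pres_eq.induct)
  case (cancel u x b v)
  then show ?case using pres_eq.cancel[of R u x b "v @ w"] by simp
next
  case (relation r s u v)
  then show ?case using pres_eq.relation[of r s R u "v @ w"] by simp
next
  case (trans u v v')
  show ?case by (rule pres_eq.trans) fact+
qed (rule pres_eq.refl, rule pres_eq.sym)

lemma pres_eq_append: "pres_eq R u u' \<Longrightarrow> pres_eq R v v' \<Longrightarrow> pres_eq R (u @ v) (u' @ v')"
  by (rule pres_eq.trans[OF pres_eq_append_right pres_eq_append_left])

lemma mult_word_class [simp]:
  "word_class R u \<otimes>\<^bsub>presented_group R\<^esub> word_class R v = word_class R (u @ v)"
proof -
  have "word_class R (u' @ v') = word_class R (u @ v)"
    if "u' \<in> word_class R u" "v' \<in> word_class R v" for u' v'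
  proof -
    have "pres_eq R (u @ v) (u' @ v')"
      using that unfolding word_class_def mem_Collect_eq by (rule pres_eq_append)
    then show ?thesis
      by (simp only: word_class_eq_iff[symmetric])
  qed
  then have "(\<Union>u'\<in>word_class R u. \<Union>v'\<in>word_class R v. word_class R (u' @ v'))
      = (\<Union>u'\<in>word_class R u. \<Union>v'\<in>word_class R v. word_class R (u @ v))"
    by (intro SUP_cong HOL.refl)
  also have "\<dots> = word_class R (u @ v)"
  proof -
    have "u \<in> word_class R u" "v \<in> word_class R v"
      by (simp_all add: word_class_def pres_eq.refl)
    then have "word_class R u \<noteq> {}" "word_class R v \<noteq> {}"
      by blast+
    then show ?thesis
      by simp
  qed
  finally show ?thesis
    by (simp add: presented_group_def)
qed

lemma carrier_presented_group: "carrier (presented_group R) = range (word_class R)"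
  by (simp add: presented_group_def)

lemma one_presented_group: "\<one>\<^bsub>presented_group R\<^esub> = word_class R []"
  by (simp add: presented_group_def)

lemma pres_eq_inverse: "pres_eq R (rev (map (\<lambda>(x, b). (x, \<not> b)) w) @ w) []"
proof (induction w)
  case (Cons l w)
  obtain x b where l: "l = (x, b)" by (cases l)
  have "pres_eq R (rev (map (\<lambda>(x, b). (x, \<not> b)) w) @ [(x, \<not> b), (x, \<not> \<not> b)] @ w)
      (rev (map (\<lambda>(x, b). (x, \<not> b)) w) @ w)"
    by (rule pres_eq.cancel)
  from pres_eq.trans[OF this Cons.IH] show ?case
    by (simp add: l)
qed (simp add: pres_eq.refl)

lemma group_presented_group: "group (presented_group R)"
proof (rule groupI)
  fix X assume "X \<in> carrier (presented_group R)"
  then obtain w where X: "X = word_class R w"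
    by (auto simp: carrier_presented_group)
  have "word_class R (rev (map (\<lambda>(x, b). (x, \<not> b)) w)) \<otimes>\<^bsub>presented_group R\<^esub> X
      = \<one>\<^bsub>presented_group R\<^esub>"
    by (simp add: X one_presented_group word_class_eq_iff pres_eq_inverse)
  then show "\<exists>Z\<in>carrier (presented_group R). Z \<otimes>\<^bsub>presented_group R\<^esub> X = \<one>\<^bsub>presented_group R\<^esub>"
    by (auto simp: carrier_presented_group)
qed (auto simp: carrier_presented_group one_presented_group)


section \<open>Baumslag-Solitar groups\<close>

datatype bs_gen = gen_a | gen_t

definition gen_pow :: "'x \<Rightarrow> int \<Rightarrow> 'x word"
  where "gen_pow x k = replicate (nat \<bar>k\<bar>) (x, 0 \<le> k)"

text \<open>\<open>BS m n\<close> is the group with generators \<open>a\<close>, \<open>t\<close> and the relation \<open>t a\<^sup>m t\<^sup>-\<^sup>1 = a\<^sup>n\<close>.\<close>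

definition BS_relations :: "int \<Rightarrow> int \<Rightarrow> (bs_gen word \<times> bs_gen word) set"
  where "BS_relations m n = {([(gen_t, True)] @ gen_pow gen_a m @ [(gen_t, False)], gen_pow gen_a n)}"

definition BS :: "int \<Rightarrow> int \<Rightarrow> bs_gen word set monoid"
  where "BS m n = presented_group (BS_relations m n)"

definition BS_a :: "int \<Rightarrow> int \<Rightarrow> bs_gen word set"
  where "BS_a m n = word_class (BS_relations m n) [(gen_a, True)]"

lemma group_BS: "group (BS m n)"
  by (simp add: BS_def group_presented_group)


section \<open>Normal closures, word metrics and negligible sets\<close>

definition normal_closure :: "('g, 'b) monoid_scheme \<Rightarrow> 'g set \<Rightarrow> 'g set"
  where "normal_closure G S = \<Inter>{H. H \<lhd> G \<and> S \<subseteq> H}"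

definition finite_generating_set :: "('g, 'b) monoid_scheme \<Rightarrow> 'g set \<Rightarrow> bool"
  where "finite_generating_set G Y \<longleftrightarrow>
    finite Y \<and> Y \<subseteq> carrier G \<and> generate G Y = carrier G"

text \<open>The value is meaningful only for \<open>g\<close> in the subgroup generated by \<open>Y\<close>.\<close>

definition word_length :: "('g, 'b) monoid_scheme \<Rightarrow> 'g set \<Rightarrow> 'g \<Rightarrow> nat"
  where "word_length G Y g =
    (LEAST k. \<exists>w. set w \<subseteq> Y \<union> m_inv G ` Y \<and> foldr (mult G) w \<one>\<^bsub>G\<^esub> = g \<and> length w = k)"

definition word_ball :: "('g, 'b) monoid_scheme \<Rightarrow> 'g set \<Rightarrow> nat \<Rightarrow> 'g set"
  where "word_ball G Y n = {g \<in> carrier G. word_length G Y g \<le> n}"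

text \<open>The limit superior is taken in the extended reals, where it always exists.\<close>

definition exponentially_negligible :: "('g, 'b) monoid_scheme \<Rightarrow> 'g set \<Rightarrow> 'g set \<Rightarrow> bool"
  where "exponentially_negligible G Y A \<longleftrightarrow>
    limsup (\<lambda>n. ereal (root n (real (card (A \<inter> word_ball G Y n)) / real (card (word_ball G Y n))))) < 1"

end

theory Submission
  imports Defs "HOL-Real_Asymp.Real_Asymp"
begin

text \<open>
  Send \<open>a\<close> to the translation \<open>x \<mapsto> x + 1\<close> and \<open>t\<close> to the dilation \<open>x \<mapsto> N x\<close>. This identifies
  \<open>BS(1,N)\<close> with a group of pairs \<open>(x, k)\<close>, where \<open>x \<in> \<int>[1/N]\<close> and
  \<open>(x, k) (x', k') = (x + N\<^sup>k x', k + k')\<close>. The height \<open>k\<close> is a homomorphism that kills \<open>a\<close>, hence the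
  normal closure \<open>A\<close> of \<open>\<langle>a\<rangle>\<close> consists of elements of height \<open>0\<close>. The task becomes to show that the
  elements of height \<open>0\<close> form an exponentially small part of the ball of radius \<open>n\<close>, for the finite
  symmetric set \<open>T\<close> of pairs that the generators become.

  An element of height \<open>0\<close> in this ball is the value of a closed word, whose prefixes trace a closed path
  of heights. Moving the base point of the path to a lowest point multiplies the offset by a power of
  \<open>N\<close>, which has only linearly many possible exponents, and cutting the path at a highest point writes
  it as an ascent \<open>u\<close> from \<open>0\<close> to some height \<open>H\<close> followed by the inverse of a second such ascent \<open>v\<close>,
  with \<open>|u| + |v| \<le> n\<close>. The offset of the closed word is then the difference of the offsets of the two
  ascents (\<open>closed_words_covered\<close>).

  If \<open>H\<close> is at most a small multiple of \<open>n\<close>, there are few such offsets for a simple reason: they have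
  a bounded denominator and size \<open>O(n |N|\<^sup>H)\<close>, while the ball of radius \<open>n\<close> grows exponentially.

  If \<open>H\<close> is larger than this multiple of \<open>n\<close>, the difference loses information. For every set \<open>S\<close> of
  \<open>s\<close> heights below \<open>H\<close> one can insert the loops \<open>N\<^sup>j\<close>, \<open>j \<in> S\<close>, into both ascents at a cost of
  \<open>O(s)\<close> letters (\<open>insert_loops\<close>), and the difference of the offsets stays the same. Different sets
  give different pairs of ascents, because sums of distinct powers of \<open>N\<close> are distinct
  (\<open>power_sum_inj\<close>). On the other hand, a pair of ascents is almost determined by its product, which
  stacks one ascent on top of the other (\<open>card_ascent_pairs\<close>). So the number of differences times the
  binomial coefficient \<open>H\<close> over \<open>s\<close> is, up to a linear factor, at most the size of the ball of radius
  \<open>n + 2Cs\<close>, and this is at most \<open>L\<^sup>s\<close> times the size of the ball of radius \<open>n\<close>, where \<open>L\<close> is the size of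
  the ball of radius \<open>2C\<close>. For \<open>s\<close> a sufficiently small multiple of \<open>n\<close> the binomial coefficient
  is at least \<open>(2L)\<^sup>s\<close>, and the differences are outnumbered by a factor \<open>2\<^sup>s\<close> up to the linear factor
  (\<open>card_height_zero_le\<close>).
\<close>

section \<open>Products and balls in the affine group\<close>

definition affine_mult :: "int \<Rightarrow> real \<times> int \<Rightarrow> real \<times> int \<Rightarrow> real \<times> int"
  where "affine_mult N g h = (fst g + of_int N powi snd g * fst h, snd g + snd h)"

definition affine_inv :: "int \<Rightarrow> real \<times> int \<Rightarrow> real \<times> int"
  where "affine_inv N g = (- (of_int N powi (- snd g) * fst g), - snd g)"

definition affine_eval :: "int \<Rightarrow> (real \<times> int) list \<Rightarrow> real \<times> int"
  where "affine_eval N w = foldr (affine_mult N) w (0, 0)"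

definition affine_ball :: "int \<Rightarrow> (real \<times> int) set \<Rightarrow> nat \<Rightarrow> (real \<times> int) set"
  where "affine_ball N T n = affine_eval N ` {w. set w \<subseteq> T \<and> length w \<le> n}"

lemma affine_mult_assoc:
  "N \<noteq> 0 \<Longrightarrow> affine_mult N (affine_mult N g h) k = affine_mult N g (affine_mult N h k)"
  by (simp add: affine_mult_def power_int_add algebra_simps)

lemma affine_eval_Nil [simp]: "affine_eval N [] = (0, 0)"
  by (simp add: affine_eval_def)

lemma affine_eval_Cons [simp]: "affine_eval N (g # w) = affine_mult N g (affine_eval N w)"
  by (simp add: affine_eval_def)

lemma affine_mult_one [simp]: "affine_mult N (0, 0) g = g" "affine_mult N g (0, 0) = g"
  by (simp_all add: affine_mult_def)

lemma affine_eval_append: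
  "N \<noteq> 0 \<Longrightarrow> affine_eval N (v @ w) = affine_mult N (affine_eval N v) (affine_eval N w)"
  by (induction v) (simp_all add: affine_mult_assoc)

lemma affine_inv_mult:
  "N \<noteq> 0 \<Longrightarrow> affine_inv N (affine_mult N g h) = affine_mult N (affine_inv N h) (affine_inv N g)"
proof -
  assume N: "N \<noteq> 0"
  have "real_of_int N powi (- (snd g + snd h)) = inverse (real_of_int N powi snd g * real_of_int N powi snd h)"
    using N by (simp only: power_int_minus) (simp add: power_int_add)
  then show ?thesis
    using N by (simp add: affine_inv_def affine_mult_def power_int_minus field_simps)
qed

lemma affine_eval_inverse_word:
  "N \<noteq> 0 \<Longrightarrow> affine_eval N (rev (map (affine_inv N) w)) = affine_inv N (affine_eval N w)"
  by (induction w) (simp_all add: affine_eval_append affine_inv_mult, simp add: affine_inv_def)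

lemma snd_affine_eval: "snd (affine_eval N w) = sum_list (map snd w)"
  by (induction w) (simp_all add: affine_mult_def)

lemma affine_eval_in_ball: "set w \<subseteq> T \<Longrightarrow> length w \<le> n \<Longrightarrow> affine_eval N w \<in> affine_ball N T n"
  by (auto simp: affine_ball_def)

lemma affine_ball_mono: "m \<le> n \<Longrightarrow> affine_ball N T m \<subseteq> affine_ball N T n"
  by (auto simp: affine_ball_def)

lemma one_in_affine_ball: "(0, 0) \<in> affine_ball N T n"
  using affine_eval_in_ball[of "[]" T n N] by simp

lemma affine_ball_mult:
  assumes "N \<noteq> 0" "g \<in> affine_ball N T m" "h \<in> affine_ball N T n"
  shows "affine_mult N g h \<in> affine_ball N T (m + n)"
proof -
  obtain v w where "set v \<subseteq> T" "length v \<le> m" "g = affine_eval N v"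
    "set w \<subseteq> T" "length w \<le> n" "h = affine_eval N w"
    using assms by (auto simp: affine_ball_def)
  then show ?thesis
    using affine_eval_in_ball[of "v @ w" T "m + n" N] assms(1) by (simp add: affine_eval_append)
qed

lemma finite_affine_ball: "finite T \<Longrightarrow> finite (affine_ball N T n)"
  unfolding affine_ball_def by (intro finite_imageI finite_lists_length_le)

lemma card_affine_ball_add:
  assumes "N \<noteq> 0" "finite T"
  shows "card (affine_ball N T (m + n)) \<le> card (affine_ball N T m) * card (affine_ball N T n)"
proof -
  have "affine_ball N T (m + n)
      \<subseteq> (\<lambda>(g, h). affine_mult N g h) ` (affine_ball N T m \<times> affine_ball N T n)"
  proof
    fix g assume "g \<in> affine_ball N T (m + n)"
    then obtain w where w: "set w \<subseteq> T" "length w \<le> m + n" "g = affine_eval N w"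
      by (auto simp: affine_ball_def)
    have "affine_eval N (take m w) \<in> affine_ball N T m"
      using w set_take_subset[of m w] by (intro affine_eval_in_ball) auto
    moreover have "affine_eval N (drop m w) \<in> affine_ball N T n"
      using w set_drop_subset[of m w] by (intro affine_eval_in_ball) auto
    moreover have "g = affine_mult N (affine_eval N (take m w)) (affine_eval N (drop m w))"
      using w(3) affine_eval_append[OF assms(1), of "take m w" "drop m w"] by simp
    ultimately show "g \<in> (\<lambda>(g, h). affine_mult N g h) ` (affine_ball N T m \<times> affine_ball N T n)"
      by force
  qed
  then have "card (affine_ball N T (m + n))
      \<le> card ((\<lambda>(g, h). affine_mult N g h) ` (affine_ball N T m \<times> affine_ball N T n))"
    using assms(2) by (intro card_mono finite_imageI finite_cartesian_product finite_affine_ball)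
  also have "\<dots> \<le> card (affine_ball N T m \<times> affine_ball N T n)"
    using assms(2) by (intro card_image_le finite_cartesian_product finite_affine_ball)
  finally show ?thesis
    by (simp add: card_cartesian_product)
qed

lemma card_affine_ball_add_mult:
  assumes "N \<noteq> 0" "finite T"
  shows "card (affine_ball N T (n + k * s)) \<le> card (affine_ball N T n) * card (affine_ball N T k) ^ s"
proof (induction s)
  case (Suc s)
  have "card (affine_ball N T (n + k * Suc s)) = card (affine_ball N T ((n + k * s) + k))"
    by (simp add: algebra_simps)
  also have "\<dots> \<le> card (affine_ball N T (n + k * s)) * card (affine_ball N T k)"
    by (rule card_affine_ball_add[OF assms])
  also have "\<dots> \<le> (card (affine_ball N T n) * card (affine_ball N T k) ^ s) * card (affine_ball N T k)"
    by (rule mult_right_mono[OF Suc]) simp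
  finally show ?case by (simp add: algebra_simps)
qed simp

section \<open>Sums of distinct powers\<close>

text \<open>
  The sums below are the offsets that inserted loops contribute. The index set consists of integers,
  because passing to a suffix of a word shifts it by the height of the removed letters.
\<close>

definition power_sum :: "int \<Rightarrow> int set \<Rightarrow> real"
  where "power_sum N S = (\<Sum>j\<in>S. of_int N powi j)"

lemma sum_abs_power_less:
  assumes "2 \<le> \<bar>N\<bar>" "D \<subseteq> {0..<int n}"
  shows "(\<Sum>j\<in>D. \<bar>real_of_int N\<bar> powi j) < \<bar>real_of_int N\<bar> ^ n"
proof -
  \<comment> \<open>The geometric sum stays below the next power exactly because the base is at least 2.\<close>
  let ?q = "\<bar>real_of_int N\<bar>"
  have q: "2 \<le> ?q" using assms(1) by linarith
  have "(\<Sum>j\<in>D. ?q powi j) \<le> (\<Sum>j\<in>{0..<int n}. ?q powi j)"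
    using assms(2) by (intro sum_mono2) auto
  also have "\<dots> = (\<Sum>j<n. ?q ^ j)"
    by (rule sum.reindex_bij_witness[of _ int nat]) (auto simp: power_int_def)
  also have "\<dots> < ?q ^ n"
  proof (induction n)
    case (Suc n)
    then have "(\<Sum>j<Suc n. ?q ^ j) < 2 * ?q ^ n" by simp
    also have "\<dots> \<le> ?q ^ Suc n" using q by (simp add: mult_right_mono)
    finally show ?case .
  qed simp
  finally show ?thesis .
qed

lemma abs_power_sum_less:
  assumes "2 \<le> \<bar>N\<bar>" "S \<subseteq> {0..<int n}"
  shows "\<bar>power_sum N S\<bar> < \<bar>real_of_int N\<bar> ^ n"
proof -
  have "\<bar>power_sum N S\<bar> \<le> (\<Sum>j\<in>S. \<bar>real_of_int N\<bar> powi j)"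
    unfolding power_sum_def by (rule order_trans[OF sum_abs]) (simp add: power_int_abs)
  then show ?thesis using sum_abs_power_less[OF assms] by linarith
qed

lemma power_sum_Int:
  assumes "S \<subseteq> {0..<int n}"
  shows "power_sum N S \<in> \<int>"
  unfolding power_sum_def using assms by (intro Ints_sum) (auto simp: power_int_def intro!: Ints_power)

text \<open>
  Consider the largest element of the symmetric difference of two sets with the same sum. Its power
  exceeds in absolute value the sum of all smaller powers with any signs, so it cannot cancel. This
  covers negative \<open>N\<close> as well.
\<close>

lemma power_sum_inj:
  assumes N: "2 \<le> \<bar>N\<bar>"
  shows "inj_on (power_sum N) (Pow {0..<int n})"
proof (rule inj_onI, rule ccontr)
  fix S S' assume S: "S \<in> Pow {0..<int n}" "S' \<in> Pow {0..<int n}"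
    and eq: "power_sum N S = power_sum N S'" and ne: "S \<noteq> S'"
  have fin: "finite S" "finite S'" using S by (auto intro: finite_subset)
  define D where "D = (S - S') \<union> (S' - S)"
  define f where "f j = (of_bool (j \<in> S) - of_bool (j \<in> S')) * real_of_int N powi j" for j
  have D: "finite D" "D \<noteq> {}" "D \<subseteq> {0..<int n}" using S fin ne by (auto simp: D_def)
  have sum: "sum f D = 0"
  proof -
    have "sum f D = sum f (S \<union> S')"
      using fin by (intro sum.mono_neutral_left) (auto simp: D_def f_def)
    also have "\<dots> = (\<Sum>j\<in>S \<union> S'. of_bool (j \<in> S) * real_of_int N powi j)
        - (\<Sum>j\<in>S \<union> S'. of_bool (j \<in> S') * real_of_int N powi j)"
      by (simp add: f_def left_diff_distrib sum_subtractf)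
    also have "(\<Sum>j\<in>S \<union> S'. of_bool (j \<in> S) * real_of_int N powi j) = power_sum N S"
      unfolding power_sum_def using fin by (intro sum.mono_neutral_cong_right) auto
    also have "(\<Sum>j\<in>S \<union> S'. of_bool (j \<in> S') * real_of_int N powi j) = power_sum N S'"
      unfolding power_sum_def using fin by (intro sum.mono_neutral_cong_right) auto
    finally show ?thesis using eq by simp
  qed
  have abs_f: "\<bar>f j\<bar> = \<bar>real_of_int N\<bar> powi j" if "j \<in> D" for j
    using that by (auto simp: D_def f_def power_int_abs)
  define m where "m = Max D"
  have m: "m \<in> D" "\<And>j. j \<in> D \<Longrightarrow> j \<le> m" using D by (auto simp: m_def)
  have "\<bar>real_of_int N\<bar> powi m = \<bar>sum f (D - {m})\<bar>"
    using sum D(1) m(1) abs_f[OF m(1)] by (simp add: sum.remove[of D m] eq_neg_iff_add_eq_0[symmetric])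
  also have "\<dots> \<le> (\<Sum>j\<in>D - {m}. \<bar>real_of_int N\<bar> powi j)"
    by (rule order_trans[OF sum_abs]) (simp add: abs_f)
  also have "\<dots> < \<bar>real_of_int N\<bar> ^ nat m"
  proof (rule sum_abs_power_less[OF N])
    show "D - {m} \<subseteq> {0..<int (nat m)}"
    proof
      fix j assume "j \<in> D - {m}"
      then show "j \<in> {0..<int (nat m)}" using m(2)[of j] D(3) by force
    qed
  qed
  also have "\<dots> = \<bar>real_of_int N\<bar> powi m"
    using m D(3) by (auto simp: power_int_def)
  finally show False by simp
qed

section \<open>Inserting loops and exponential growth\<close>

text \<open>
  These are the properties that the image of the letters \<open>Y \<union> Y\<^sup>-\<^sup>1\<close> inherits from a finite generating
  set \<open>Y\<close> of \<open>BS(1,N)\<close>. The common denominator expresses that the offsets lie in \<open>\<int>[1/N]\<close>, and the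
  last two assumptions say that \<open>T\<close> generates the affine images of \<open>a\<close> and \<open>t\<close>.
\<close>

locale affine_generators =
  fixes N :: int and T :: "(real \<times> int) set"
  assumes N: "2 \<le> \<bar>N\<bar>"
    and fin: "finite T"
    and symmetric: "g \<in> T \<Longrightarrow> affine_inv N g \<in> T"
    and common_denominator: "\<exists>c. \<forall>g\<in>T. fst g * of_int N ^ c \<in> \<int>"
    and generates_a: "\<exists>n. (1, 0) \<in> affine_ball N T n"
    and generates_t: "\<exists>n. (0, 1) \<in> affine_ball N T n"
begin

abbreviation ev where "ev \<equiv> affine_eval N"
abbreviation ball where "ball \<equiv> affine_ball N T"
abbreviation q :: real where "q \<equiv> \<bar>real_of_int N\<bar>"
abbreviation height :: "(real \<times> int) list \<Rightarrow> int" where "height w \<equiv> snd (ev w)"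
abbreviation offset :: "(real \<times> int) list \<Rightarrow> real" where "offset w \<equiv> fst (ev w)"

lemma N_nonzero: "N \<noteq> 0" using N by auto

lemma finite_ball: "finite (ball n)"
  by (rule finite_affine_ball[OF fin])

lemma card_ball_pos: "0 < card (ball n)"
  using finite_ball one_in_affine_ball by (metis card_gt_0_iff empty_iff)

lemma ball_inv: "g \<in> ball n \<Longrightarrow> affine_inv N g \<in> ball n"
proof -
  assume "g \<in> ball n"
  then obtain w where w: "set w \<subseteq> T" "length w \<le> n" "g = ev w"
    by (auto simp: affine_ball_def)
  then have "ev (rev (map (affine_inv N) w)) \<in> ball n"
    using symmetric by (intro affine_eval_in_ball) auto
  then show ?thesis using w(3) by (simp add: affine_eval_inverse_word N_nonzero)
qed

lemma height_append: "height (v @ w) = height v + height w"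
  by (simp add: snd_affine_eval)

lemma bounded_height: "\<exists>M::nat. \<forall>w. set w \<subseteq> T \<longrightarrow> \<bar>height w\<bar> \<le> int M * int (length w)"
proof -
  define M where "M = Max (insert 0 ((\<lambda>g. nat \<bar>snd g\<bar>) ` T))"
  have M: "\<bar>snd g\<bar> \<le> int M" if "g \<in> T" for g
  proof -
    have "nat \<bar>snd g\<bar> \<le> M"
      unfolding M_def using fin that by (intro Max_ge) auto
    then show ?thesis by linarith
  qed
  have "\<bar>height w\<bar> \<le> int M * int (length w)" if "set w \<subseteq> T" for w
    using that
  proof (induction w)
    case (Cons g w)
    then have "\<bar>height w\<bar> \<le> int M * int (length w)" "\<bar>snd g\<bar> \<le> int M" using M by auto
    then show ?case by (simp add: affine_mult_def algebra_simps)
  qed simp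
  then show ?thesis by blast
qed

text \<open>
  The loop that adds \<open>N\<^sup>j\<close> is the conjugate of \<open>a\<close> by \<open>t\<^sup>j\<close>.
\<close>

lemma loops: "\<exists>n. (of_int N powi int j, 0) \<in> ball n"
proof -
  obtain a where a: "(1, 0) \<in> ball a" using generates_a by blast
  obtain t where t: "(0, 1) \<in> ball t" using generates_t by blast
  show ?thesis
  proof (induction j)
    case 0
    show ?case using a by auto
  next
    case (Suc j)
    then obtain n where n: "(of_int N powi int j, 0) \<in> ball n" by blast
    have "affine_mult N (affine_mult N (0, 1) (of_int N powi int j, 0)) (affine_inv N (0, 1)) \<in> ball ((t + n) + t)"
      by (intro affine_ball_mult ball_inv N_nonzero t n)
    moreover have "affine_mult N (affine_mult N (0, 1) (of_int N powi int j, 0)) (affine_inv N (0, 1))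
        = (of_int N powi int (Suc j), 0)"
      using N_nonzero by (simp add: affine_mult_def affine_inv_def power_int_add)
    ultimately show ?case by auto
  qed
qed

lemma power_sum_in_ball:
  assumes C: "\<And>j. 0 \<le> j \<Longrightarrow> j < M \<Longrightarrow> (of_int N powi j, 0) \<in> ball C"
  assumes "S \<subseteq> {0..<M}"
  shows "(power_sum N S, 0) \<in> ball (C * card S)"
proof -
  have "finite S" using assms(2) by (auto intro: finite_subset)
  then show ?thesis using assms(2)
  proof (induction S)
    case empty
    show ?case using one_in_affine_ball by (simp add: power_sum_def)
  next
    case (insert j S)
    then have "affine_mult N (of_int N powi j, 0) (power_sum N S, 0) \<in> ball (C + C * card S)"
      by (intro affine_ball_mult N_nonzero C) auto
    then show ?case using insert.hyps by (simp add: affine_mult_def power_sum_def)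
  qed
qed

lemma power_sum_shift: "power_sum N S = of_int N powi k * power_sum N ((\<lambda>j. j - k) ` S)"
proof -
  have "power_sum N ((\<lambda>j. j - k) ` S) = (\<Sum>j\<in>S. of_int N powi (j - k))"
    unfolding power_sum_def by (subst sum.reindex) (auto simp: inj_on_def)
  then show ?thesis
    using N_nonzero by (simp add: power_sum_def sum_distrib_left power_int_diff)
qed

text \<open>
  A word that ends at height \<open>H\<close> passes every height below \<open>H\<close> up to an error of one letter. At the letter
  that jumps over height \<open>j\<close>, the loop with offset \<open>N\<^sup>j\<close> can be inserted; measured from the height of
  that letter it is one of finitely many loops, so its length is bounded by a constant. The induction
  treats the first letter \<open>g\<close> with the heights in \<open>{0..<snd g}\<close> and passes the remaining heights,
  shifted, to the rest of the word.
\<close>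

lemma insert_loops:
  "\<exists>C. \<forall>w S. set w \<subseteq> T \<longrightarrow> S \<subseteq> {0..<height w} \<longrightarrow>
     (offset w + power_sum N S, height w) \<in> ball (length w + C * card S)"
proof -
  obtain M :: nat where height: "\<And>w. set w \<subseteq> T \<Longrightarrow> \<bar>height w\<bar> \<le> int M * int (length w)"
    using bounded_height by blast
  have M: "snd g \<le> int M" if "g \<in> T" for g
    using height[of "[g]"] that by (simp add: affine_mult_def)
  obtain l where l: "\<And>j. (of_int N powi int j, 0) \<in> ball (l j)" using loops by metis
  define C where "C = (\<Sum>j<M. l j)"
  have C: "(of_int N powi j, 0) \<in> ball C" if "0 \<le> j" "j < int M" for j
  proof -
    have "l (nat j) \<le> C" unfolding C_def using that by (intro member_le_sum) auto
    then show ?thesis using l[of "nat j"] affine_ball_mono that by fastforce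
  qed
  have "(offset w + power_sum N S, height w) \<in> ball (length w + C * card S)"
    if "set w \<subseteq> T" "S \<subseteq> {0..<height w}" for w S
    using that
  proof (induction w arbitrary: S)
    case Nil
    then show ?case using one_in_affine_ball by (simp add: power_sum_def)
  next
    case (Cons g w)
    have finS: "finite S" using Cons.prems by (auto intro: finite_subset)
    \<comment> \<open>The heights in S1 are crossed by the letter g, those in S2 by the rest of the word.
      If g descends, S1 is empty.\<close>
    define S1 where "S1 = {j \<in> S. j < snd g}"
    define S2 where "S2 = (\<lambda>j. j - snd g) ` {j \<in> S. snd g \<le> j}"
    have "g \<in> T" using Cons.prems by simp
    have "S1 \<subseteq> {0..<int M}"
      using Cons.prems M[OF \<open>g \<in> T\<close>] by (auto simp: S1_def)
    with C have 1: "(power_sum N S1, 0) \<in> ball (C * card S1)" by (rule power_sum_in_ball)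
    have "affine_eval N [g] \<in> ball 1" using \<open>g \<in> T\<close> by (intro affine_eval_in_ball) auto
    then have 2: "g \<in> ball 1" by simp
    have "S2 \<subseteq> {0..<height w}" using Cons.prems by (auto simp: S2_def affine_mult_def)
    then have 3: "(offset w + power_sum N S2, height w) \<in> ball (length w + C * card S2)"
      using Cons by auto
    have "card S2 = card {j \<in> S. snd g \<le> j}"
      unfolding S2_def by (intro card_image) (auto simp: inj_on_def)
    then have "card S1 + card S2 = card ({j \<in> S. j < snd g} \<union> {j \<in> S. snd g \<le> j})"
      unfolding S1_def using finS by (subst card_Un_disjoint) auto
    also have "{j \<in> S. j < snd g} \<union> {j \<in> S. snd g \<le> j} = S" by auto
    finally have card: "card S = card S1 + card S2" ..
    have "power_sum N S = power_sum N S1 + power_sum N {j \<in> S. snd g \<le> j}"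
      unfolding power_sum_def S1_def using finS
      by (subst sum.union_disjoint[symmetric]) (auto intro!: sum.cong)
    also have "power_sum N {j \<in> S. snd g \<le> j} = of_int N powi snd g * power_sum N S2"
      unfolding S2_def by (rule power_sum_shift)
    finally have sum: "power_sum N S = power_sum N S1 + of_int N powi snd g * power_sum N S2" .
    have "affine_mult N (affine_mult N (power_sum N S1, 0) g) (offset w + power_sum N S2, height w)
        \<in> ball ((C * card S1 + 1) + (length w + C * card S2))"
      by (intro affine_ball_mult N_nonzero 1 2 3)
    moreover have "affine_mult N (affine_mult N (power_sum N S1, 0) g) (offset w + power_sum N S2, height w)
        = (offset (g # w) + power_sum N S, height (g # w))"
      by (simp add: affine_mult_def sum algebra_simps)
    ultimately show ?case by (simp add: card algebra_simps)
  qed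
  then show ?thesis by blast
qed

text \<open>
  Inserting loops into a word for \<open>t\<^sup>n\<close> produces \<open>2\<^sup>n\<close> elements of height \<open>n\<close>, one for each set of
  heights.
\<close>

lemma exponential_growth: "\<exists>p>0. \<forall>n. 2 ^ n \<le> card (ball (p * n))"
proof -
  obtain C where C: "\<And>w S. set w \<subseteq> T \<Longrightarrow> S \<subseteq> {0..<height w} \<Longrightarrow>
      (offset w + power_sum N S, height w) \<in> ball (length w + C * card S)"
    using insert_loops by blast
  obtain t where t: "set t \<subseteq> T" "ev t = (0, 1)"
    using generates_t by (force simp: affine_ball_def)
  define p where "p = length t + C + 1"
  have "2 ^ n \<le> card (ball (p * n))" for n
  proof -
    define w where "w = concat (replicate n t)"
    have w: "set w \<subseteq> T" "length w = length t * n" "ev w = (0, int n)"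
      unfolding w_def using t
      by (induction n) (auto simp: affine_eval_append N_nonzero affine_mult_def)
    have "(\<lambda>S. (power_sum N S, int n)) ` Pow {0..<int n} \<subseteq> ball (p * n)"
    proof clarify
      fix S assume S: "S \<subseteq> {0..<int n}"
      then have "(power_sum N S, int n) \<in> ball (length w + C * card S)"
        using C[of w S] w by simp
      moreover have "C * card S \<le> C * n"
        by (rule mult_le_mono2) (use card_mono[OF _ S] in simp)
      then have "length w + C * card S \<le> p * n"
        unfolding w(2) p_def distrib_right by linarith
      ultimately show "(power_sum N S, int n) \<in> ball (p * n)" using affine_ball_mono by blast
    qed
    then have "card ((\<lambda>S. (power_sum N S, int n)) ` Pow {0..<int n}) \<le> card (ball (p * n))"
      using finite_ball by (intro card_mono)
    moreover have "inj_on (\<lambda>S. (power_sum N S, int n)) (Pow {0..<int n})"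
      using power_sum_inj[OF N, of n] by (auto simp: inj_on_def)
    ultimately show ?thesis by (simp add: card_image card_Pow)
  qed
  moreover have "p > 0" by (simp add: p_def)
  ultimately show ?thesis by blast
qed

end

context affine_generators
begin

section \<open>Closed words as differences of ascents\<close>

text \<open>
  This set contains the offsets of all words of length at most \<open>n\<close> whose heights stay in the strip from
  \<open>0\<close> to \<open>H\<close>: below the strip they would need larger denominators, above it they would outgrow
  \<open>|N|\<^sup>H\<close>. The constants \<open>c\<close> and \<open>K\<close> depend only on the generators.
\<close>

definition lattice_box :: "nat \<Rightarrow> nat \<Rightarrow> nat \<Rightarrow> nat \<Rightarrow> real set"
  where "lattice_box c K n H = {x. x * of_int N ^ c \<in> \<int> \<and> \<bar>x\<bar> \<le> real K * real n * q ^ H}"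

lemma q_ge: "2 \<le> q" using N by linarith

lemma lattice_box_mono:
  assumes "m \<le> n"
  shows "lattice_box c K m H \<subseteq> lattice_box c K n H"
proof -
  have "real K * real m * q ^ H \<le> real K * real n * q ^ H"
    using assms by (intro mult_right_mono mult_left_mono) auto
  then show ?thesis by (auto simp: lattice_box_def)
qed

lemma lattice_box_add:
  assumes "x \<in> lattice_box c K m H" "y \<in> lattice_box c K n H"
  shows "x + y \<in> lattice_box c K (m + n) H"
  using assms by (auto simp: lattice_box_def algebra_simps)

lemma lattice_box_minus: "x \<in> lattice_box c K n H \<Longrightarrow> - x \<in> lattice_box c K n H"
  by (simp add: lattice_box_def)

lemma lattice_box_power_sum:
  assumes "S \<subseteq> {0..<int H}" "K > 0"
  shows "power_sum N S \<in> lattice_box c K 1 H"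
proof -
  have "1 * q ^ H \<le> real K * q ^ H" using assms(2) by (intro mult_right_mono) auto
  then show ?thesis
    using abs_power_sum_less[OF N assms(1)] power_sum_Int[OF assms(1)]
    by (auto simp: lattice_box_def)
qed

lemma count_scaled_integers:
  assumes "\<And>x. x \<in> X \<Longrightarrow> x * of_int N ^ c \<in> \<int> \<and> \<bar>x * of_int N ^ c\<bar> \<le> B"
  shows "finite X" and "real (card X) \<le> 2 * B + 1 \<or> X = {}"
proof -
  have inj: "inj_on (\<lambda>x. \<lfloor>x * of_int N ^ c\<rfloor>) X"
  proof (rule inj_onI)
    fix x y assume x: "x \<in> X" "y \<in> X" and eq: "\<lfloor>x * of_int N ^ c\<rfloor> = \<lfloor>y * of_int N ^ c\<rfloor>"
    then have "x * of_int N ^ c = y * of_int N ^ c" using assms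
      by (metis of_int_floor)
    then show "x = y" using N_nonzero by simp
  qed
  have sub: "(\<lambda>x. \<lfloor>x * of_int N ^ c\<rfloor>) ` X \<subseteq> {- \<lfloor>B\<rfloor>..\<lfloor>B\<rfloor>}"
  proof clarify
    fix x assume "x \<in> X"
    then obtain k where "x * of_int N ^ c = of_int k" "\<bar>x * of_int N ^ c\<bar> \<le> B"
      using assms Ints_cases by metis
    then show "\<lfloor>x * of_int N ^ c\<rfloor> \<in> {- \<lfloor>B\<rfloor>..\<lfloor>B\<rfloor>}"
      by simp linarith
  qed
  show "finite X" using finite_subset[OF sub] finite_imageD[OF _ inj] by auto
  have "card X \<le> card {- \<lfloor>B\<rfloor>..\<lfloor>B\<rfloor>}"
    using card_mono[OF _ sub] by (simp add: card_image[OF inj])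
  then show "real (card X) \<le> 2 * B + 1 \<or> X = {}"
  proof (cases "X = {}")
    case False
    then obtain x where "x \<in> X" by auto
    then have "0 \<le> B" using assms[of x] by auto
    moreover have "real (card X) \<le> real (card {- \<lfloor>B\<rfloor>..\<lfloor>B\<rfloor>})" using \<open>card X \<le> _\<close> by simp
    ultimately show ?thesis by simp linarith
  qed simp
qed

lemma card_lattice_box:
  "finite (lattice_box c K n H)"
  "real (card (lattice_box c K n H)) \<le> 2 * (real K * real n * q ^ (H + c)) + 1"
proof -
  have *: "x * of_int N ^ c \<in> \<int> \<and> \<bar>x * of_int N ^ c\<bar> \<le> real K * real n * q ^ (H + c)"
    if "x \<in> lattice_box c K n H" for x
  proof -
    have "\<bar>x * of_int N ^ c\<bar> = \<bar>x\<bar> * q ^ c" by (simp add: abs_mult power_abs)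
    also have "\<dots> \<le> (real K * real n * q ^ H) * q ^ c"
      using that by (intro mult_right_mono) (auto simp: lattice_box_def)
    finally show ?thesis using that by (simp add: lattice_box_def power_add algebra_simps)
  qed
  have "0 \<in> lattice_box c K n H" by (simp add: lattice_box_def)
  then show "finite (lattice_box c K n H)"
    "real (card (lattice_box c K n H)) \<le> 2 * (real K * real n * q ^ (H + c)) + 1"
    using count_scaled_integers[where c = c, OF *] by auto
qed

text \<open>
  A letter with offset \<open>y\<close> read at height \<open>h\<close> contributes \<open>N\<^sup>h y\<close>. For \<open>0 \<le> h \<le> H\<close> this needs no
  larger denominator than \<open>y\<close> and is at most \<open>K |N|\<^sup>H\<close>. The starting height \<open>h\<close> is arbitrary in order to
  cover also the second part of a closed word, which starts at its highest point.
\<close>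

lemma strip_words_in_box:
  "\<exists>c K. K > 0 \<and> (\<forall>w H. \<forall>h\<ge>0. set w \<subseteq> T \<longrightarrow>
     (\<forall>k. h + height (take k w) \<in> {0..int H}) \<longrightarrow>
     of_int N powi h * offset w \<in> lattice_box c K (length w) H)"
proof -
  obtain c where c: "\<And>g. g \<in> T \<Longrightarrow> fst g * of_int N ^ c \<in> \<int>" using common_denominator by blast
  define K where "K = Suc (\<Sum>g\<in>T. nat \<lceil>\<bar>fst g\<bar>\<rceil>)"
  have K: "\<bar>fst g\<bar> \<le> real K" if "g \<in> T" for g
  proof -
    have "nat \<lceil>\<bar>fst g\<bar>\<rceil> \<le> (\<Sum>g\<in>T. nat \<lceil>\<bar>fst g\<bar>\<rceil>)" using that fin by (intro member_le_sum) auto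
    then show ?thesis unfolding K_def by linarith
  qed
  have "of_int N powi h * offset w \<in> lattice_box c K (length w) H"
    if "set w \<subseteq> T" "\<And>k. h + height (take k w) \<in> {0..int H}" for w H h
    using that
  proof (induction w arbitrary: h)
    case Nil
    then show ?case by (simp add: lattice_box_def)
  next
    case (Cons g w)
    have h: "0 \<le> h" "h \<le> int H" using Cons.prems(2)[of 0] by auto
    have "h + snd g + height (take k w) \<in> {0..int H}" for k
      using Cons.prems(2)[of "Suc k"] by (simp add: affine_mult_def add.assoc)
    then have IH: "of_int N powi (h + snd g) * offset w \<in> lattice_box c K (length w) H"
      using Cons.prems(1) by (intro Cons.IH) auto
    have "of_int N powi h * fst g \<in> lattice_box c K 1 H"
    proof -
      have g: "g \<in> T" using Cons.prems(1) by simp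
      have pw: "real_of_int N powi h = of_int N ^ nat h" using h by (simp add: power_int_def)
      have "q ^ nat h \<le> q ^ H" using h q_ge by (intro power_increasing) auto
      then have "q ^ nat h * \<bar>fst g\<bar> \<le> q ^ H * real K" using K[OF g] by (intro mult_mono) auto
      moreover have "real_of_int N ^ nat h * (fst g * of_int N ^ c) \<in> \<int>"
        by (rule Ints_mult[OF Ints_power[OF Ints_of_int] c[OF g]])
      ultimately show ?thesis by (simp add: lattice_box_def pw abs_mult power_abs algebra_simps)
    qed
    from lattice_box_add[OF this IH] show ?case
      using N_nonzero by (simp add: affine_mult_def power_int_add algebra_simps)
  qed
  then show ?thesis using zero_less_Suc unfolding K_def by blast
qed

text \<open>
  A cyclic rotation of a closed word conjugates its value by the removed prefix, so the offset is
  multiplied by a power of \<open>N\<close>. Starting at a lowest point keeps all heights nonnegative.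
\<close>

lemma rotate_to_lowest:
  assumes "set w \<subseteq> T" "height w = 0"
  obtains w' k where "set w' \<subseteq> T" "length w' = length w" "height w' = 0"
    "\<And>i. 0 \<le> height (take i w')" "k \<le> length w"
    "offset w = of_int N powi height (take k w) * offset w'"
proof -
  let ?h = "\<lambda>i. height (take i w)"
  obtain k where k: "k \<le> length w" "\<And>i. i \<le> length w \<Longrightarrow> ?h k \<le> ?h i"
    using arg_min_if_finite(1)[of "{..length w}" ?h] arg_min_least[of "{..length w}" _ ?h]
    by (metis atMost_iff empty_iff finite_atMost order_refl)
  have k': "?h k \<le> ?h i" for i
    using k(2)[of i] k(2)[of "length w"] by (cases "i \<le> length w") auto
  have split: "ev w = affine_mult N (ev (take k w)) (ev (drop k w))"
    using affine_eval_append[OF N_nonzero, of "take k w" "drop k w"] by simp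
  then have hd: "height (drop k w) = - ?h k"
    using assms(2) by (simp add: affine_mult_def)
  show ?thesis
  proof
    show "set (drop k w @ take k w) \<subseteq> T"
      using assms(1) set_drop_subset[of k w] set_take_subset[of k w] by auto
    show "length (drop k w @ take k w) = length w" using k by simp
    show "height (drop k w @ take k w) = 0" by (simp add: height_append hd)
    show "0 \<le> height (take i (drop k w @ take k w))" for i
    proof (cases "i \<le> length w - k")
      case True
      have "?h (k + i) = ?h k + height (take i (drop k w))"
        by (simp add: take_add height_append)
      then show ?thesis using k'[of "k + i"] True by simp
    next
      case False
      then have "height (take i (drop k w @ take k w)) = - ?h k + ?h (min (i - (length w - k)) k)"
        by (simp add: height_append hd)
      then show ?thesis using k'[of "min (i - (length w - k)) k"] by simp
    qed
    show "offset w = of_int N powi ?h k * offset (drop k w @ take k w)"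
      using split hd N_nonzero
      by (simp add: affine_eval_append affine_mult_def power_int_minus field_simps)
  qed (fact k)
qed

text \<open>
  The two ascents \<open>u\<close> and \<open>v\<close> share the length \<open>n\<close>, and only their end points are fixed. That their
  heights stay in the strip is remembered through the membership of the offsets in the box; inserting
  loops may lead the paths out of the strip, but keeps the offsets in a slightly larger box.
\<close>

definition ascent_differences :: "nat \<Rightarrow> nat \<Rightarrow> nat \<Rightarrow> nat \<Rightarrow> real set"
  where "ascent_differences c K n H =
    {x - z | x z. x \<in> lattice_box c K n H \<and> z \<in> lattice_box c K n H \<and>
      (\<exists>u v. set u \<subseteq> T \<and> set v \<subseteq> T \<and> length u + length v \<le> n \<and>
         ev u = (x, int H) \<and> ev v = (z, int H))}"

lemma closed_words_covered:
  "\<exists>c K M. K > 0 \<and> (\<forall>n. {x. (x, 0) \<in> ball n} \<subseteq>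
     (\<Union>m\<in>{- int (M * n)..int (M * n)}. \<Union>H\<le>M * n. (\<lambda>x. of_int N powi m * x) ` ascent_differences c K n H))"
proof -
  obtain c K where K: "K > 0" and box: "\<And>w H h. h \<ge> 0 \<Longrightarrow> set w \<subseteq> T \<Longrightarrow>
     (\<And>k. h + height (take k w) \<in> {0..int H}) \<Longrightarrow>
     of_int N powi h * offset w \<in> lattice_box c K (length w) H"
    using strip_words_in_box by blast
  obtain M :: nat where "\<And>w. set w \<subseteq> T \<Longrightarrow> \<bar>height w\<bar> \<le> int M * int (length w)"
    using bounded_height by blast
  then have M: "\<bar>height (take k w)\<bar> \<le> int (M * n)" if "set w \<subseteq> T" "length w \<le> n" for k w n
  proof -
    have "\<bar>height (take k w)\<bar> \<le> int M * int (length (take k w))"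
      using that set_take_subset[of k w] \<open>\<And>w. set w \<subseteq> T \<Longrightarrow> _\<close> by blast
    also have "\<dots> \<le> int M * int n" using that by (intro mult_left_mono) auto
    finally show ?thesis by simp
  qed
  have main: "x \<in> (\<Union>m\<in>{- int (M * n)..int (M * n)}. \<Union>H\<le>M * n. (\<lambda>x. of_int N powi m * x) ` ascent_differences c K n H)"
    if x: "(x, 0) \<in> ball n" for x n
  proof -
    obtain w0 where w0': "set w0 \<subseteq> T" "length w0 \<le> n" "(x, 0) = ev w0"
      using x unfolding affine_ball_def by blast
    note w0 = w0'(1,2) w0'(3)[symmetric]
    then have "height w0 = 0" by simp
    then obtain w k where w: "set w \<subseteq> T" "length w = length w0" "height w = 0"
      "\<And>i. 0 \<le> height (take i w)"
      "offset w0 = of_int N powi height (take k w0) * offset w"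
      using rotate_to_lowest[OF w0(1)] by metis
    let ?h = "\<lambda>i. height (take i w)"
    obtain j where j: "j \<le> length w" "\<And>i. i \<le> length w \<Longrightarrow> ?h i \<le> ?h j"
      using arg_min_if_finite(1)[of "{..length w}" "\<lambda>i. - ?h i"] arg_min_least[of "{..length w}" _ "\<lambda>i. - ?h i"]
      by (metis atMost_iff empty_iff finite_atMost order_refl neg_le_iff_le)
    have j': "?h i \<le> ?h j" for i
      using j(2)[of i] j(2)[of "length w"] by (cases "i \<le> length w") auto
    define H where "H = nat (?h j)"
    have H: "int H = ?h j" using w(4) by (simp add: H_def)
    define u where "u = take j w"
    define v where "v = drop j w"
    have uv: "ev w = affine_mult N (ev u) (ev v)"
      using affine_eval_append[OF N_nonzero, of u v] by (simp add: u_def v_def)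
    have hu: "height u = int H" by (simp add: u_def H)
    have hv: "height v = - int H" using uv hu w(3) by (simp add: affine_mult_def)
    have T: "set u \<subseteq> T" "set v \<subseteq> T"
      using w(1) set_drop_subset[of j w] set_take_subset[of j w] by (auto simp: u_def v_def)
    have len: "length u + length v \<le> n" using w0 w(2) j by (simp add: u_def v_def)
    \<comment> \<open>The descent v, read backwards with inverted letters, is the second ascent.\<close>
    define v' where "v' = rev (map (affine_inv N) v)"
    have v': "set v' \<subseteq> T" "length v' = length v" "ev v' = (- (of_int N powi int H * offset v), int H)"
      using T symmetric hv unfolding v'_def by (auto simp: affine_eval_inverse_word N_nonzero affine_inv_def)
    have "of_int N powi 0 * offset u \<in> lattice_box c K (length u) H"
      using T w(4) j' by (intro box) (auto simp: u_def H min_def)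
    then have 1: "offset u \<in> lattice_box c K n H"
      using lattice_box_mono[of "length u" n] len by auto
    have "of_int N powi int H * offset v \<in> lattice_box c K (length v) H"
    proof (rule box)
      fix i
      have "int H + height (take i v) = ?h (j + i)"
        by (simp add: take_add height_append v_def H)
      then show "int H + height (take i v) \<in> {0..int H}" using w(4) j' H by auto
    qed (use T in auto)
    then have 2: "- (of_int N powi int H * offset v) \<in> lattice_box c K n H"
      using lattice_box_mono[of "length v" n] len lattice_box_minus by (metis le_add2 order_trans subsetD)
    have "offset w = offset u - (- (of_int N powi int H * offset v))"
      using uv hu by (simp add: affine_mult_def)
    moreover have "ev u = (offset u, int H)" using hu by (simp add: prod_eq_iff)
    ultimately have "offset w \<in> ascent_differences c K n H"
      unfolding ascent_differences_def using 1 2 T v' len by (metis (mono_tags, lifting) mem_Collect_eq)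
    moreover have "x = of_int N powi height (take k w0) * offset w" using w(5) w0(3) by simp
    moreover have "height (take k w0) \<in> {- int (M * n)..int (M * n)}"
      using M[OF w0(1,2), of k] by auto
    moreover have "H \<le> M * n"
    proof -
      have "\<bar>?h j\<bar> \<le> int (M * n)" using M[of w n j] w(1,2) w0(2) by simp
      then show ?thesis unfolding H[symmetric] by linarith
    qed
    ultimately show ?thesis by blast
  qed
  show ?thesis
  proof (intro exI conjI allI subsetI)
    show "0 < K" by (fact K)
    fix n x assume "x \<in> {x. (x, 0) \<in> ball n}"
    then show "x \<in> (\<Union>m\<in>{- int (M * n)..int (M * n)}. \<Union>H\<le>M * n.
        (\<lambda>x. of_int N powi m * x) ` ascent_differences c K n H)"
      unfolding mem_Collect_eq by (rule main)
  qed
qed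

end

context affine_generators
begin

section \<open>Counting differences of ascents\<close>

lemma finite_ascent_differences: "finite (ascent_differences c K n H)"
  and card_ascent_differences_low:
    "real (card (ascent_differences c K n H)) \<le> (4 * real K * q ^ c + 1) * (real n + 1) * q ^ H"
proof -
  have sub: "ascent_differences c K n H \<subseteq> lattice_box c K (n + n) H"
  proof
    fix d assume "d \<in> ascent_differences c K n H"
    then obtain x z where "d = x - z" "x \<in> lattice_box c K n H" "z \<in> lattice_box c K n H"
      unfolding ascent_differences_def by blast
    then show "d \<in> lattice_box c K (n + n) H"
      using lattice_box_add[of x c K n H "- z" n] lattice_box_minus by simp
  qed
  then show "finite (ascent_differences c K n H)" using card_lattice_box(1) finite_subset by blast
  have "1 \<le> q ^ H" using q_ge by simp
  have "real (card (ascent_differences c K n H)) \<le> real (card (lattice_box c K (n + n) H))"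
    using card_mono[OF card_lattice_box(1) sub] by simp
  also have "\<dots> \<le> 2 * (real K * real (n + n) * q ^ (H + c)) + 1" by (rule card_lattice_box)
  also have "\<dots> \<le> 2 * (real K * real (n + n) * q ^ (H + c)) + 1 * q ^ H"
    using \<open>1 \<le> q ^ H\<close> by simp
  also have "\<dots> = (4 * real K * q ^ c * real n + 1) * q ^ H"
    by (simp add: power_add algebra_simps)
  also have "\<dots> \<le> ((4 * real K * q ^ c + 1) * (real n + 1)) * q ^ H"
    by (intro mult_right_mono) (auto simp: algebra_simps)
  finally show "real (card (ascent_differences c K n H)) \<le> (4 * real K * q ^ c + 1) * (real n + 1) * q ^ H" .
qed

text \<open>
  The product of the two ascents has offset \<open>x + N\<^sup>H z\<close> and height \<open>2H\<close>. It determines \<open>x N\<^sup>c\<close> modulo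
  \<open>N\<^sup>H\<close>, and in the box there are only linearly many elements with a given residue; the floor below
  tells them apart.
\<close>

lemma card_ascent_pairs:
  fixes c K n H n' :: nat
  defines "P \<equiv> {(x, z). x \<in> lattice_box c K n H \<and> z \<in> lattice_box c K n H \<and>
      (\<exists>k l. k + l \<le> n' \<and> (x, int H) \<in> ball k \<and> (z, int H) \<in> ball l)}"
  shows "finite P" "card P \<le> (2 * (K * n * nat \<bar>N\<bar> ^ c) + 1) * card (ball n')"
proof -
  define b where "b = int (K * n * nat \<bar>N\<bar> ^ c)"
  define f where "f = (\<lambda>(x :: real, z :: real). ((x + of_int N ^ H * z, 2 * int H), \<lfloor>x * of_int N ^ c / of_int N ^ H\<rfloor>))"
  have inj: "inj_on f P"
  proof (rule inj_onI, clarify)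
    fix x z x' z' assume P: "(x, z) \<in> P" "(x', z') \<in> P" and eq: "f (x, z) = f (x', z')"
    define y where "y = (z' - z) * of_int N ^ c"
    have "z * of_int N ^ c \<in> \<int>" "z' * of_int N ^ c \<in> \<int>"
      using P by (auto simp: P_def lattice_box_def)
    then have "y \<in> \<int>" unfolding y_def left_diff_distrib by (intro Ints_diff)
    have "x - x' = of_int N ^ H * (z' - z)" using eq by (simp add: f_def algebra_simps)
    then have "y = (x - x') * of_int N ^ c / of_int N ^ H"
      using N_nonzero by (simp add: y_def)
    also have "\<dots> = x * of_int N ^ c / of_int N ^ H - x' * of_int N ^ c / of_int N ^ H"
      by (simp add: left_diff_distrib diff_divide_distrib)
    finally have "\<bar>y\<bar> < 1" using eq unfolding f_def by simp linarith
    with \<open>y \<in> \<int>\<close> have "y = 0" by (auto elim!: Ints_cases)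
    then have "z = z'" using N_nonzero by (simp add: y_def)
    then show "x = x' \<and> z = z'" using eq by (simp add: f_def)
  qed
  have sub: "f ` P \<subseteq> ball n' \<times> {- b..b}"
  proof (rule image_subsetI, clarify)
    fix x z assume P: "(x, z) \<in> P"
    then obtain k l where kl: "k + l \<le> n'" "(x, int H) \<in> ball k" "(z, int H) \<in> ball l"
      by (auto simp: P_def)
    have "affine_mult N (x, int H) (z, int H) \<in> ball (k + l)"
      using kl by (intro affine_ball_mult N_nonzero)
    then have "(x + of_int N ^ H * z, 2 * int H) \<in> ball n'"
      using subsetD[OF affine_ball_mono[OF kl(1)]] by (simp add: affine_mult_def)
    moreover have "\<lfloor>x * of_int N ^ c / of_int N ^ H\<rfloor> \<in> {- b..b}"
    proof -
      define y where "y = x * of_int N ^ c / of_int N ^ H"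
      have "\<bar>y\<bar> = \<bar>x\<bar> * q ^ c / q ^ H"
        by (simp add: y_def abs_mult power_abs)
      also have "\<dots> \<le> (real K * real n * q ^ H) * q ^ c / q ^ H"
        using P by (intro divide_right_mono mult_right_mono) (auto simp: P_def lattice_box_def)
      also have "\<dots> = of_int b" using N_nonzero by (simp add: b_def)
      finally have "\<lfloor>y\<rfloor> \<in> {- b..b}" by (simp add: le_floor_iff floor_le_iff) linarith
      then show ?thesis by (simp only: y_def)
    qed
    ultimately show "f (x, z) \<in> ball n' \<times> {- b..b}" by (simp add: f_def)
  qed
  have fin: "finite (ball n' \<times> {- b..b})" using finite_ball by simp
  show "finite P" using finite_subset[OF sub fin] finite_imageD[OF _ inj] by blast
  have "card P \<le> card (ball n' \<times> {- b..b})"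
    using card_mono[OF fin sub] by (simp add: card_image[OF inj])
  also have "\<dots> = (2 * (K * n * nat \<bar>N\<bar> ^ c) + 1) * card (ball n')"
  proof -
    have "card {- b..b} = nat (2 * b + 1)" by simp
    also have "\<dots> = 2 * (K * n * nat \<bar>N\<bar> ^ c) + 1" unfolding b_def by linarith
    finally show ?thesis by (simp add: card_cartesian_product mult.commute)
  qed
  finally show "card P \<le> (2 * (K * n * nat \<bar>N\<bar> ^ c) + 1) * card (ball n')" .
qed

text \<open>
  The pairs of ascents obtained from one difference by inserting the same loops on both sides are
  distinct and have that difference again. So the pairs number at least the differences times the choices
  of \<open>s\<close> heights out of \<open>H\<close>.
\<close>

lemma card_ascent_differences_high:
  "\<exists>C. \<forall>c K n H s. K > 0 \<longrightarrow> card (ascent_differences c K n H) * (H choose s)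
     \<le> (2 * (K * (n + 1) * nat \<bar>N\<bar> ^ c) + 1) * card (ball (n + 2 * C * s))"
proof -
  obtain C where C: "\<And>w S. set w \<subseteq> T \<Longrightarrow> S \<subseteq> {0..<height w} \<Longrightarrow>
      (offset w + power_sum N S, height w) \<in> ball (length w + C * card S)"
    using insert_loops by blast
  have "card (ascent_differences c K n H) * (H choose s)
     \<le> (2 * (K * (n + 1) * nat \<bar>N\<bar> ^ c) + 1) * card (ball (n + 2 * C * s))" if K: "K > 0" for c K n H s
  proof -
    let ?D = "ascent_differences c K n H"
    let ?S = "{S. S \<subseteq> {0..<int H} \<and> card S = s}"
    let ?P = "{(x, z). x \<in> lattice_box c K (n + 1) H \<and> z \<in> lattice_box c K (n + 1) H \<and>
      (\<exists>k l. k + l \<le> n + 2 * C * s \<and> (x, int H) \<in> ball k \<and> (z, int H) \<in> ball l)}"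
    have "\<forall>d\<in>?D. \<exists>x z. d = x - z \<and> x \<in> lattice_box c K n H \<and> z \<in> lattice_box c K n H \<and>
      (\<exists>u v. set u \<subseteq> T \<and> set v \<subseteq> T \<and> length u + length v \<le> n \<and>
         ev u = (x, int H) \<and> ev v = (z, int H))"
      unfolding ascent_differences_def by blast
    then obtain X Z where XZ: "\<And>d. d \<in> ?D \<Longrightarrow> d = X d - Z d \<and> X d \<in> lattice_box c K n H \<and>
      Z d \<in> lattice_box c K n H \<and> (\<exists>u v. set u \<subseteq> T \<and> set v \<subseteq> T \<and> length u + length v \<le> n \<and>
         ev u = (X d, int H) \<and> ev v = (Z d, int H))"
      by metis
    define f where "f = (\<lambda>(d, S). (X d + power_sum N S, Z d + power_sum N S))"
    \<comment> \<open>The difference of the two components recovers d, and then the first component recovers S.\<close>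
    have inj: "inj_on f (?D \<times> ?S)"
    proof (rule inj_onI, clarify)
      fix d d' S S' assume d: "d \<in> ?D" "d' \<in> ?D" and S: "S \<subseteq> {0..<int H}" "S' \<subseteq> {0..<int H}"
        and eq: "f (d, S) = f (d', S')"
      have "d = d'" using eq XZ[OF d(1)] XZ[OF d(2)] by (simp add: f_def)
      then have "power_sum N S = power_sum N S'" using eq by (simp add: f_def)
      then have "S = S'" using inj_onD[OF power_sum_inj[OF N, of H]] S by blast
      with \<open>d = d'\<close> show "d = d' \<and> S = S'" by simp
    qed
    have sub: "f ` (?D \<times> ?S) \<subseteq> ?P"
    proof (rule image_subsetI)
      fix e assume "e \<in> ?D \<times> ?S"
      then obtain d S where e: "e = (d, S)" and d: "d \<in> ?D" and S: "S \<subseteq> {0..<int H}" "card S = s"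
        by blast
      obtain u v where uv: "set u \<subseteq> T" "set v \<subseteq> T" "length u + length v \<le> n"
         "ev u = (X d, int H)" "ev v = (Z d, int H)"
        using XZ[OF d] by blast
      have "(X d + power_sum N S, int H) \<in> ball (length u + C * s)"
        "(Z d + power_sum N S, int H) \<in> ball (length v + C * s)"
        using C[of u S] C[of v S] uv S by auto
      moreover have "(length u + C * s) + (length v + C * s) \<le> n + 2 * C * s"
        using uv(3) by simp
      \<comment> \<open>The inserted sum is smaller than the H-th power of q, so it enlarges the box by one step only.\<close>
      moreover have "X d + power_sum N S \<in> lattice_box c K (n + 1) H"
        "Z d + power_sum N S \<in> lattice_box c K (n + 1) H"
        using XZ[OF d] lattice_box_power_sum[OF S(1) K] lattice_box_add by blast+
      ultimately show "f e \<in> ?P" unfolding e f_def case_prod_conv mem_Collect_eq by blast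
    qed
    have "card ?D * (H choose s) = card (?D \<times> ?S)"
      by (simp add: card_cartesian_product n_subsets)
    also have "\<dots> \<le> card ?P"
      using card_mono[OF card_ascent_pairs(1) sub] by (simp add: card_image[OF inj])
    also have "\<dots> \<le> (2 * (K * (n + 1) * nat \<bar>N\<bar> ^ c) + 1) * card (ball (n + 2 * C * s))"
      by (rule card_ascent_pairs(2))
    finally show ?thesis .
  qed
  then show ?thesis by blast
qed

section \<open>The proportion of elements of height zero\<close>

text \<open>
  The threshold \<open>n \<le> H E\<close> separates the two ways of counting. The constant \<open>E\<close> makes \<open>|N|\<^sup>H\<close> at most the
  square root of the growth \<open>2\<^bsup>n/p\<^esup>\<close> of the balls when \<open>H E \<le> n\<close>. The constant \<open>F\<close> makes \<open>s = n div F\<close> so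
  small in comparison with \<open>H \<ge> n/E\<close> that \<open>H/s \<ge> 2L\<close>, which leaves a gain of \<open>2\<^sup>s\<close> over the price \<open>L\<^sup>s\<close> of the
  inserted loops. The cubic factor comes from the number of rotations, the number of values of \<open>H\<close> and
  the linear factor in each count.
\<close>

lemma card_height_zero_le:
  "\<exists>Q \<theta>. 0 < \<theta> \<and> \<theta> < 1 \<and> 0 \<le> Q \<and> (\<forall>n. real (card {x. (x, 0) \<in> ball n})
     \<le> Q * (real n + 1) ^ 3 * \<theta> ^ n * real (card (ball n)))"
proof -
  obtain c K M where K: "K > 0" and cover: "\<And>n. {x. (x, 0) \<in> ball n} \<subseteq>
     (\<Union>m\<in>{- int (M * n)..int (M * n)}. \<Union>H\<le>M * n. (\<lambda>x. of_int N powi m * x) ` ascent_differences c K n H)"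
    using closed_words_covered by blast
  obtain C where C: "\<And>c K n H s. K > 0 \<Longrightarrow> card (ascent_differences c K n H) * (H choose s)
     \<le> (2 * (K * (n + 1) * nat \<bar>N\<bar> ^ c) + 1) * card (ball (n + 2 * C * s))"
    using card_ascent_differences_high by blast
  obtain p where p: "p > 0" "\<And>n. 2 ^ n \<le> card (ball (p * n))" using exponential_growth by blast
  define r where "r = nat \<bar>N\<bar>"
  define L where "L = card (ball (2 * C))"
  define E where "E = 2 * r * p"
  define F where "F = 2 * E * L"
  define \<theta> where "\<theta> = 2 powr (- (1 / real F))"
  have r: "r > 0" "q \<le> 2 ^ r"
  proof -
    have "q = real r" by (simp add: r_def)
    also have "\<dots> \<le> real (2 ^ r)" using less_exp[of r] by (intro of_nat_mono) simp
    finally show "q \<le> 2 ^ r" by simp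
  qed (use N in \<open>simp add: r_def\<close>)
  have L: "L > 0" unfolding L_def by (rule card_ball_pos)
  have E: "E > 0" using r p by (simp add: E_def)
  have F: "F > 0" using E L by (simp add: F_def)
  have \<theta>: "0 < \<theta>" "\<theta> < 1" using F by (auto simp: \<theta>_def intro: powr_less_one)
  have \<theta>n: "\<theta> ^ n = 2 powr (- (real n / real F))" for n
    by (simp add: \<theta>_def powr_power)
  define Q1 where "Q1 = 4 * real K * q ^ c + 1"
  have Q1: "Q1 \<ge> 0" by (simp add: Q1_def)
  have one: "real (card (ascent_differences c K n H)) \<le> 2 * Q1 * (real n + 1) * \<theta> ^ n * real (card (ball n))"
    for n H
  proof (cases "H * E \<le> n")
    case True
    \<comment> \<open>Half of the exponent n / p of the growth pays for the powers of q, and the other half is the gain.\<close>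
    have div: "real n / real p \<le> real (n div p) + 1"
      by (metis floor_divide_of_nat_eq of_int_of_nat_eq real_of_int_floor_add_one_ge)
    have "2 ^ (n div p) \<le> card (ball (p * (n div p)))" by (rule p)
    also have "\<dots> \<le> card (ball n)" by (intro card_mono finite_ball affine_ball_mono) simp
    finally have ball: "2 ^ (n div p) \<le> card (ball n)" .
    have "real (r * H) \<le> real n / (2 * real p)"
    proof -
      have "real (r * H) * (2 * real p) = real (H * E)" by (simp add: E_def)
      also have "\<dots> \<le> real n" using True by (rule of_nat_mono)
      finally show ?thesis using p(1) by (simp add: pos_le_divide_eq)
    qed
    also have "\<dots> = real n / real p - real n / (2 * real p)" using p(1) by (simp add: field_simps)
    also have "\<dots> \<le> real n / real p - real n / real F"
    proof -
      have "2 * p * 1 \<le> 2 * p * (2 * r * L)" using r L by (intro mult_le_mono2) simp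
      also have "2 * p * (2 * r * L) = F" by (simp add: F_def E_def)
      finally have "2 * p \<le> F" by simp
      then have "2 * real p \<le> real F" using of_nat_mono[of "2 * p" F] by simp
      then have "real n / real F \<le> real n / (2 * real p)"
        using p(1) by (intro divide_left_mono) auto
      then show ?thesis by simp
    qed
    also have "\<dots> \<le> (real (n div p) + 1) + (- (real n / real F))" using div by simp
    finally have exp: "real (r * H) \<le> (real (n div p) + 1) + (- (real n / real F))" .
    have "q ^ H \<le> (2 ^ r) ^ H" using r by (intro power_mono) auto
    also have "\<dots> = 2 powr real (r * H)" by (simp add: powr_realpow power_mult del: of_nat_mult)
    also have "\<dots> \<le> 2 powr ((real (n div p) + 1) + (- (real n / real F)))"
      using exp by (intro powr_mono) auto
    also have "\<dots> = 2 * 2 ^ (n div p) * \<theta> ^ n"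
      unfolding \<theta>n powr_add by (simp add: powr_realpow)
    also have "\<dots> \<le> 2 * real (card (ball n)) * \<theta> ^ n"
    proof -
      have "(2::real) ^ (n div p) \<le> real (card (ball n))" using of_nat_mono[OF ball, where 'a = real] by simp
      then show ?thesis using \<theta> by simp
    qed
    finally have qH: "q ^ H \<le> 2 * real (card (ball n)) * \<theta> ^ n" .
    have "real (card (ascent_differences c K n H)) \<le> Q1 * (real n + 1) * q ^ H"
      unfolding Q1_def by (rule card_ascent_differences_low)
    also have "\<dots> \<le> Q1 * (real n + 1) * (2 * real (card (ball n)) * \<theta> ^ n)"
      using qH Q1 by (intro mult_left_mono) auto
    finally show ?thesis by (simp add: algebra_simps)
  next
    case False
    define s where "s = n div F"
    have sF: "s * F \<le> n" by (simp add: s_def)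
    have "s * F \<le> H * E" using sF False by simp
    then have "(s * (2 * L)) * E \<le> H * E" by (simp add: F_def algebra_simps)
    then have sH: "s * (2 * L) \<le> H" using E by simp
    have "s \<le> s * (2 * L)" using L by simp
    then have "s \<le> H" using sH by linarith
    \<comment> \<open>The standard bound (H / s) ^ s for the binomial coefficient; for s = 0 both sides are 1.\<close>
    have bin: "(2 * real L) ^ s \<le> real (H choose s)"
    proof (cases "s = 0")
      case False
      have "real s * (2 * real L) \<le> real H" using of_nat_mono[OF sH, where 'a = real] by simp
      then have "2 * real L \<le> real H / real s" using False by (simp add: field_simps)
      then have "(2 * real L) ^ s \<le> (real H / real s) ^ s" by (intro power_mono) auto
      also have "\<dots> \<le> real (H choose s)" by (rule binomial_ge_n_over_k_pow_k[OF \<open>s \<le> H\<close>])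
      finally show ?thesis .
    qed simp
    let ?B = "real (2 * (K * (n + 1) * nat \<bar>N\<bar> ^ c) + 1)"
    have "real (card (ascent_differences c K n H)) * (2 * real L) ^ s
        \<le> real (card (ascent_differences c K n H)) * real (H choose s)"
      using bin by (intro mult_left_mono) auto
    also have "\<dots> = real (card (ascent_differences c K n H) * (H choose s))" by simp
    also have "\<dots> \<le> real ((2 * (K * (n + 1) * nat \<bar>N\<bar> ^ c) + 1) * card (ball (n + 2 * C * s)))"
      by (intro of_nat_mono C K)
    also have "\<dots> = ?B * real (card (ball (n + 2 * C * s)))" by (rule of_nat_mult)
    also have "\<dots> \<le> ?B * real (card (ball n) * L ^ s)"
      unfolding L_def by (intro mult_left_mono of_nat_mono card_affine_ball_add_mult N_nonzero fin) simp
    also have "\<dots> = ?B * real (card (ball n)) * real L ^ s" by simp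
    finally have "(real (card (ascent_differences c K n H)) * 2 ^ s) * real L ^ s
        \<le> (?B * real (card (ball n))) * real L ^ s"
      by (simp add: power_mult_distrib mult.assoc)
    then have main: "real (card (ascent_differences c K n H)) * 2 ^ s \<le> ?B * real (card (ball n))"
      using L by (subst (asm) mult_le_cancel_right_pos) simp_all
    have B: "?B \<le> Q1 * (real n + 1)"
    proof -
      have "?B = 2 * real K * q ^ c * (real n + 1) + 1" by (simp add: algebra_simps)
      also have "\<dots> \<le> (4 * real K * q ^ c) * (real n + 1) + 1 * (real n + 1)"
        by (intro add_mono mult_right_mono) auto
      finally show ?thesis by (simp add: Q1_def algebra_simps)
    qed
    have div: "real n / real F \<le> real s + 1"
      unfolding s_def by (metis floor_divide_of_nat_eq of_int_of_nat_eq real_of_int_floor_add_one_ge)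
    \<comment> \<open>Rounding in s = n div F costs at most a factor 2.\<close>
    have "1 = 2 powr (real n / real F) * \<theta> ^ n"
      unfolding \<theta>n by (simp add: powr_add[symmetric])
    also have "\<dots> \<le> 2 powr (real s + 1) * \<theta> ^ n"
      using div \<theta> by (intro mult_right_mono powr_mono) auto
    also have "\<dots> = 2 ^ s * 2 * \<theta> ^ n" by (simp add: powr_add powr_realpow)
    finally have "1 \<le> 2 ^ s * 2 * \<theta> ^ n" .
    then have "real (card (ascent_differences c K n H)) * 1
        \<le> real (card (ascent_differences c K n H)) * (2 ^ s * 2 * \<theta> ^ n)"
      by (intro mult_left_mono) auto
    also have "\<dots> = (real (card (ascent_differences c K n H)) * 2 ^ s) * (2 * \<theta> ^ n)" by simp
    also have "\<dots> \<le> (?B * real (card (ball n))) * (2 * \<theta> ^ n)"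
      using main \<theta> by (intro mult_right_mono) auto
    also have "\<dots> \<le> (Q1 * (real n + 1) * real (card (ball n))) * (2 * \<theta> ^ n)"
      using B \<theta> by (intro mult_right_mono) auto
    finally show ?thesis by (simp add: algebra_simps)
  qed
  define Q where "Q = 2 * Q1 * (2 * real M + 1) ^ 2"
  have "real (card {x. (x, 0) \<in> ball n}) \<le> Q * (real n + 1) ^ 3 * \<theta> ^ n * real (card (ball n))" for n
  proof -
    let ?R = "2 * Q1 * (real n + 1) * \<theta> ^ n * real (card (ball n))"
    let ?U = "\<lambda>m. \<Union>H\<le>M * n. (\<lambda>x. of_int N powi m * x) ` ascent_differences c K n H"
    have R: "0 \<le> ?R" using Q1 \<theta> by simp
    have step: "real (card (?U m)) \<le> real (M * n + 1) * ?R" for m :: int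
    proof -
      have "real (card (?U m)) \<le> real (\<Sum>H\<le>M * n. card ((\<lambda>x. of_int N powi m * x) ` ascent_differences c K n H))"
        by (intro of_nat_mono card_UN_le) simp
      also have "\<dots> = (\<Sum>H\<le>M * n. real (card ((\<lambda>x. of_int N powi m * x) ` ascent_differences c K n H)))"
        by simp
      also have "\<dots> \<le> (\<Sum>H\<le>M * n. ?R)"
      proof (rule sum_mono)
        fix H
        have "real (card ((\<lambda>x. of_int N powi m * x) ` ascent_differences c K n H))
            \<le> real (card (ascent_differences c K n H))"
          by (intro of_nat_mono card_image_le finite_ascent_differences)
        then show "real (card ((\<lambda>x. of_int N powi m * x) ` ascent_differences c K n H)) \<le> ?R"
          using one[of n H] by linarith
      qed
      finally show ?thesis by simp
    qed
    have "real (card {x. (x, 0) \<in> ball n}) \<le> real (card (\<Union>m\<in>{- int (M * n)..int (M * n)}. ?U m))"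
      using cover finite_ascent_differences by (intro of_nat_mono card_mono finite_UN_I finite_imageI) auto
    also have "\<dots> \<le> real (\<Sum>m\<in>{- int (M * n)..int (M * n)}. card (?U m))"
      by (intro of_nat_mono card_UN_le) simp
    also have "\<dots> = (\<Sum>m\<in>{- int (M * n)..int (M * n)}. real (card (?U m)))" by simp
    also have "\<dots> \<le> (\<Sum>m\<in>{- int (M * n)..int (M * n)}. real (M * n + 1) * ?R)"
      by (intro sum_mono step)
    also have "\<dots> = (2 * real (M * n) + 1) * (real (M * n + 1) * ?R)"
      by simp
    also have "\<dots> \<le> ((2 * real M + 1) * (real n + 1)) * (((2 * real M + 1) * (real n + 1)) * ?R)"
    proof (rule mult_mono[OF _ mult_right_mono[OF _ R]])
      show "2 * real (M * n) + 1 \<le> (2 * real M + 1) * (real n + 1)"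
        "real (M * n + 1) \<le> (2 * real M + 1) * (real n + 1)"
        by (simp_all add: algebra_simps)
      show "0 \<le> real (M * n + 1) * ?R" by (rule mult_nonneg_nonneg[OF of_nat_0_le_iff R])
    qed simp
    also have "\<dots> = Q * (real n + 1) ^ 3 * \<theta> ^ n * real (card (ball n))"
      by (simp add: Q_def power2_eq_square power3_eq_cube)
    finally show ?thesis .
  qed
  moreover have "0 \<le> Q" using Q1 by (simp add: Q_def)
  ultimately show ?thesis using \<theta> by blast
qed

end

text \<open>
  The \<open>n\<close>-th root of a polynomial tends to \<open>1\<close>. The constant \<open>Q\<close> is replaced by \<open>Q + 1\<close> in order that
  the \<open>n\<close>-th root tends to \<open>1\<close> even for \<open>Q = 0\<close>.
\<close>

lemma limsup_root_less_one:
  fixes f :: "nat \<Rightarrow> real"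
  assumes "0 < \<theta>" "\<theta> < 1" "0 \<le> Q" "\<And>n. 0 \<le> f n" "\<And>n. f n \<le> Q * (real n + 1) ^ 3 * \<theta> ^ n"
  shows "limsup (\<lambda>n. ereal (root n (f n))) < 1"
proof -
  define g where "g n = (Q + 1) powr (1 / real n) * (real n + 1) powr (3 / real n) * \<theta>" for n
  have "g \<longlonglongrightarrow> 1 * 1 * \<theta>"
    unfolding g_def
  proof (intro tendsto_intros)
    show "(\<lambda>n. (Q + 1) powr (1 / real n)) \<longlonglongrightarrow> 1"
      using assms(3) by real_asymp
    show "(\<lambda>n. (real n + 1) powr (3 / real n)) \<longlonglongrightarrow> 1"
      by real_asymp
  qed
  then have lim: "limsup (\<lambda>n. ereal (g n)) = ereal \<theta>"
    by (intro lim_imp_Limsup) auto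
  have "limsup (\<lambda>n. ereal (root n (f n))) \<le> limsup (\<lambda>n. ereal (g n))"
  proof (intro Limsup_mono eventually_sequentiallyI[of 1])
    fix n :: nat assume n: "1 \<le> n"
    have "f n \<le> (Q + 1) * (real n + 1) ^ 3 * \<theta> ^ n"
      using assms(1) by (intro order_trans[OF assms(5)] mult_right_mono) auto
    then have "root n (f n) \<le> root n ((Q + 1) * (real n + 1) ^ 3 * \<theta> ^ n)"
      using n by simp
    also have "\<dots> = root n (Q + 1) * root n ((real n + 1) ^ 3) * root n (\<theta> ^ n)"
      by (simp add: real_root_mult)
    also have "root n (\<theta> ^ n) = \<theta>" using n assms(1) by (simp add: real_root_power_cancel)
    also have "root n (Q + 1) = (Q + 1) powr (1 / real n)"
      using n assms(3) by (simp add: root_powr_inverse)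
    also have "root n ((real n + 1) ^ 3) = (real n + 1) powr (3 / real n)"
      using n by (simp add: root_powr_inverse powr_realpow[symmetric] powr_powr del: powr_numeral)
    finally show "ereal (root n (f n)) \<le> ereal (g n)" by (simp add: g_def)
  qed
  then show ?thesis using lim assms(2) by (simp add: order_le_less_trans)
qed

section \<open>The affine model of the group BS(1,N)\<close>

fun letter_affine :: "bs_gen \<times> bool \<Rightarrow> real \<times> int" where
  "letter_affine (gen_a, b) = (if b then 1 else - 1, 0)"
| "letter_affine (gen_t, b) = (0, if b then 1 else - 1)"

definition word_affine :: "int \<Rightarrow> bs_gen word \<Rightarrow> real \<times> int"
  where "word_affine N w = affine_eval N (map letter_affine w)"

text \<open>
  By \<open>word_affine_pres_eq\<close> the image of a class of words is a singleton, so the choice of its element is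
  the induced map on the quotient.
\<close>

definition BS_affine :: "int \<Rightarrow> bs_gen word set \<Rightarrow> real \<times> int"
  where "BS_affine N X = the_elem (word_affine N ` X)"

lemma word_affine_append:
  "N \<noteq> 0 \<Longrightarrow> word_affine N (u @ v) = affine_mult N (word_affine N u) (word_affine N v)"
  by (simp add: word_affine_def affine_eval_append)

lemma word_affine_gen_pow_a: "word_affine N (gen_pow gen_a k) = (of_int k, 0)"
proof -
  have "affine_eval N (replicate n (s, 0)) = (real n * s, 0)" for n s
    by (induction n) (simp_all add: affine_mult_def algebra_simps)
  then show ?thesis by (auto simp: word_affine_def gen_pow_def map_replicate_const)
qed

lemma word_affine_pres_eq:
  assumes "N \<noteq> 0" "pres_eq (BS_relations 1 N) u v"
  shows "word_affine N u = word_affine N v"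
  using assms(2)
proof induction
  case (cancel u x b v)
  have "word_affine N [(x, b), (x, \<not> b)] = (0, 0)"
    by (cases x; cases b) (simp_all add: word_affine_def affine_mult_def)
  then show ?case by (simp only: word_affine_append[OF assms(1)] affine_mult_one)
next
  case (relation r s u v)
  then have rs: "r = [(gen_t, True)] @ gen_pow gen_a 1 @ [(gen_t, False)]" "s = gen_pow gen_a N"
    by (auto simp: BS_relations_def)
  have "word_affine N r = word_affine N s"
    unfolding rs word_affine_append[OF assms(1)] word_affine_gen_pow_a
    by (simp add: word_affine_def affine_mult_def)
  then show ?case by (simp only: word_affine_append[OF assms(1)])
qed auto

lemma BS_affine_word_class:
  assumes "N \<noteq> 0"
  shows "BS_affine N (word_class (BS_relations 1 N) w) = word_affine N w"
proof -
  have "word_affine N ` word_class (BS_relations 1 N) w = {word_affine N w}"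
    using word_affine_pres_eq[OF assms] pres_eq.refl by (fastforce simp: word_class_def)
  then show ?thesis by (simp add: BS_affine_def)
qed

lemma carrier_BS: "carrier (BS m n) = range (word_class (BS_relations m n))"
  by (simp add: BS_def carrier_presented_group)

lemma one_BS: "\<one>\<^bsub>BS m n\<^esub> = word_class (BS_relations m n) []"
  by (simp add: BS_def one_presented_group)

lemma mult_BS: "word_class (BS_relations m n) u \<otimes>\<^bsub>BS m n\<^esub> word_class (BS_relations m n) v
    = word_class (BS_relations m n) (u @ v)"
  by (simp add: BS_def)

lemma BS_affine_one: "N \<noteq> 0 \<Longrightarrow> BS_affine N \<one>\<^bsub>BS 1 N\<^esub> = (0, 0)"
  by (simp add: one_BS BS_affine_word_class word_affine_def)

lemma BS_affine_mult:
  assumes "N \<noteq> 0" "X \<in> carrier (BS 1 N)" "Z \<in> carrier (BS 1 N)"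
  shows "BS_affine N (X \<otimes>\<^bsub>BS 1 N\<^esub> Z) = affine_mult N (BS_affine N X) (BS_affine N Z)"
proof -
  obtain u v where "X = word_class (BS_relations 1 N) u" "Z = word_class (BS_relations 1 N) v"
    using assms by (auto simp: carrier_BS)
  then show ?thesis using assms(1) by (simp add: mult_BS BS_affine_word_class word_affine_append)
qed

lemma BS_affine_inv:
  assumes N: "N \<noteq> 0" and X: "X \<in> carrier (BS 1 N)"
  shows "BS_affine N (inv\<^bsub>BS 1 N\<^esub> X) = affine_inv N (BS_affine N X)"
proof -
  interpret group "BS 1 N" by (rule group_BS)
  have "affine_mult N (BS_affine N X) (BS_affine N (inv\<^bsub>BS 1 N\<^esub> X)) = (0, 0)"
    using BS_affine_mult[OF N X inv_closed[OF X]] X by (simp add: BS_affine_one[OF N])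
  then have "affine_mult N (affine_mult N (affine_inv N (BS_affine N X)) (BS_affine N X)) (BS_affine N (inv\<^bsub>BS 1 N\<^esub> X))
      = affine_inv N (BS_affine N X)"
    by (simp add: affine_mult_assoc[OF N])
  moreover have "affine_mult N (affine_inv N (BS_affine N X)) (BS_affine N X) = (0, 0)"
    by (simp add: affine_mult_def affine_inv_def)
  ultimately show ?thesis by simp
qed

text \<open>
  The relation says that \<open>t a\<^sup>m = a\<^bsup>Nm\<^esup> t\<close> and \<open>a\<^sup>m t\<^sup>-\<^sup>1 = t\<^sup>-\<^sup>1 a\<^bsup>Nm\<^esup>\<close>. So powers of \<open>t\<close> can be moved to the
  right past powers of \<open>a\<close>, and powers of \<open>t\<^sup>-\<^sup>1\<close> to the left, and the set of elements in normal form
  is closed under multiplication from the left by \<open>a\<close>, \<open>t\<close> and their inverses.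
\<close>

lemma (in group) ascending_normal_form:
  fixes N :: int
  assumes a: "a \<in> carrier G" and t: "t \<in> carrier G" and rel: "t \<otimes> a \<otimes> inv t = a [^] N"
    and g: "g \<in> generate G {a, t}"
  shows "\<exists>(i::nat) (m::int) (j::nat). g = inv t [^] i \<otimes> a [^] m \<otimes> t [^] j"
proof -
  have cancel: "inv t \<otimes> (t \<otimes> z) = z" "t \<otimes> (inv t \<otimes> z) = z" if "z \<in> carrier G" for z
    using t that by (simp_all flip: m_assoc)
  have conj: "t \<otimes> a [^] m \<otimes> inv t = a [^] (N * m)" for m :: int
  proof -
    have "(\<lambda>x. t \<otimes> x \<otimes> inv t) \<in> hom G G"
      using t by (auto simp: hom_def m_assoc cancel)
    then have "(\<lambda>x. t \<otimes> x \<otimes> inv t) (a [^] m) = ((\<lambda>x. t \<otimes> x \<otimes> inv t) a) [^] m"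
      by (rule hom_int_pow[OF _ a is_group is_group])
    then show ?thesis using a by (simp add: rel int_pow_pow)
  qed
  have t_left: "t \<otimes> a [^] m = a [^] (N * m) \<otimes> t" for m :: int
    using a t by (simp add: m_assoc flip: conj)
  have a_right: "a [^] m \<otimes> inv t = inv t \<otimes> a [^] (m * N)" for m :: int
  proof -
    have "a [^] m \<otimes> inv t = inv t \<otimes> (t \<otimes> a [^] m) \<otimes> inv t"
      using a t by (simp add: cancel)
    then show ?thesis using a t by (simp add: t_left m_assoc mult.commute)
  qed
  have a_right_pow: "a [^] m \<otimes> inv t [^] i = inv t [^] i \<otimes> a [^] (m * N ^ i)" for m :: int and i :: nat
  proof (induction i)
    case (Suc i)
    have "a [^] m \<otimes> inv t [^] Suc i = (a [^] m \<otimes> inv t [^] i) \<otimes> inv t"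
      using a t by (simp add: m_assoc)
    also have "\<dots> = inv t [^] i \<otimes> (a [^] (m * N ^ i) \<otimes> inv t)"
      using a t by (simp add: Suc m_assoc)
    also have "\<dots> = inv t [^] Suc i \<otimes> a [^] (m * N ^ Suc i)"
      using a t by (simp add: a_right m_assoc mult.assoc mult.commute[of N])
    finally show ?case .
  qed (use a in simp)
  define NF where "NF = {inv t [^] i \<otimes> a [^] m \<otimes> t [^] j | (i::nat) (m::int) (j::nat). True}"
  have a_mult: "a [^] (k::int) \<otimes> g \<in> NF" if gNF: "g \<in> NF" for k g
  proof -
    obtain i j :: nat and m :: int where g: "g = inv t [^] i \<otimes> a [^] m \<otimes> t [^] j"
      using gNF by (auto simp: NF_def)
    have "a [^] k \<otimes> g = (a [^] k \<otimes> inv t [^] i) \<otimes> a [^] m \<otimes> t [^] j"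
      using a t by (simp add: g m_assoc)
    also have "\<dots> = inv t [^] i \<otimes> (a [^] (k * N ^ i) \<otimes> a [^] m) \<otimes> t [^] j"
      using a t by (simp add: a_right_pow m_assoc)
    also have "\<dots> = inv t [^] i \<otimes> a [^] (k * N ^ i + m) \<otimes> t [^] j"
      using a by (simp add: int_pow_mult)
    finally show ?thesis unfolding NF_def by blast
  qed
  have t_mult: "t \<otimes> g \<in> NF" if gNF: "g \<in> NF" for g
  proof -
    obtain i j :: nat and m :: int where g: "g = inv t [^] i \<otimes> a [^] m \<otimes> t [^] j"
      using gNF by (auto simp: NF_def)
    show ?thesis
    proof (cases i)
      case 0
      have "t \<otimes> g = (t \<otimes> a [^] m) \<otimes> t [^] j" using a t by (simp add: g 0 m_assoc)
      also have "\<dots> = inv t [^] (0::nat) \<otimes> a [^] (N * m) \<otimes> t [^] Suc j"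
        using a t nat_pow_Suc2[OF t, of j] by (simp add: t_left m_assoc)
      finally show ?thesis unfolding NF_def by blast
    next
      case (Suc i')
      have "inv t [^] i = inv t \<otimes> inv t [^] i'"
        unfolding Suc using t by (intro nat_pow_Suc2) simp
      then have "t \<otimes> g = inv t [^] i' \<otimes> a [^] m \<otimes> t [^] j"
        using a t by (simp add: g m_assoc cancel)
      then show ?thesis unfolding NF_def by blast
    qed
  qed
  have t_inv_mult: "inv t \<otimes> g \<in> NF" if gNF: "g \<in> NF" for g
  proof -
    obtain i j :: nat and m :: int where g: "g = inv t [^] i \<otimes> a [^] m \<otimes> t [^] j"
      using gNF by (auto simp: NF_def)
    have "inv t \<otimes> g = (inv t \<otimes> inv t [^] i) \<otimes> a [^] m \<otimes> t [^] j"
      using a t by (simp add: g m_assoc)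
    also have "inv t \<otimes> inv t [^] i = inv t [^] Suc i"
      using t by (intro nat_pow_Suc2[symmetric]) simp
    finally show ?thesis unfolding NF_def by blast
  qed
  have NF_carrier: "NF \<subseteq> carrier G" using a t by (auto simp: NF_def)
  have "g \<otimes> x \<in> NF" if "x \<in> NF" for x
    using g that
  proof (induction arbitrary: x)
    case one
    then show ?case using NF_carrier by auto
  next
    case (incl h)
    then show ?case using a_mult[of x 1] t_mult a by (auto simp: int_pow_1)
  next
    case (inv h)
    then show ?case using a_mult[of x "-1"] t_inv_mult a by (auto simp: int_pow_neg int_pow_1)
  next
    case (eng h1 h2)
    then have "h1 \<otimes> (h2 \<otimes> x) \<in> NF" by blast
    moreover have "h1 \<in> carrier G" "h2 \<in> carrier G" "x \<in> carrier G"
      using eng generate_in_carrier[of "{a, t}"] a t NF_carrier by auto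
    ultimately show ?case by (simp add: m_assoc)
  qed
  moreover have "\<one> = inv t [^] (0::nat) \<otimes> a [^] (0::int) \<otimes> t [^] (0::nat)" using a t by simp
  then have "\<one> \<in> NF" unfolding NF_def by blast
  ultimately have "g \<otimes> \<one> \<in> NF" by blast
  moreover have "g \<in> carrier G" using g generate_in_carrier[of "{a, t}"] a t by auto
  ultimately show ?thesis unfolding NF_def by auto
qed

definition BS_t :: "int \<Rightarrow> int \<Rightarrow> bs_gen word set"
  where "BS_t m n = word_class (BS_relations m n) [(gen_t, True)]"

lemma BS_generators_closed: "BS_a m n \<in> carrier (BS m n)" "BS_t m n \<in> carrier (BS m n)"
  by (auto simp: BS_a_def BS_t_def carrier_BS)

lemma inv_BS_letter:
  "inv\<^bsub>BS m n\<^esub> word_class (BS_relations m n) [(x, b)] = word_class (BS_relations m n) [(x, \<not> b)]"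
proof -
  interpret group "BS m n" by (rule group_BS)
  have "pres_eq (BS_relations m n) [(x, \<not> b), (x, b)] []"
    using pres_eq.cancel[of "BS_relations m n" "[]" x "\<not> b" "[]"] by simp
  then have "word_class (BS_relations m n) [(x, \<not> b)] \<otimes>\<^bsub>BS m n\<^esub> word_class (BS_relations m n) [(x, b)] = \<one>\<^bsub>BS m n\<^esub>"
    by (simp add: mult_BS one_BS word_class_eq_iff)
  then show ?thesis by (intro inv_equality) (auto simp: carrier_BS)
qed

lemma BS_generated: "generate (BS m n) {BS_a m n, BS_t m n} = carrier (BS m n)"
proof
  interpret group "BS m n" by (rule group_BS)
  let ?gen = "generate (BS m n) {BS_a m n, BS_t m n}"
  show "?gen \<subseteq> carrier (BS m n)" using BS_generators_closed by (intro generate_incl) auto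
  have letter: "word_class (BS_relations m n) [l] \<in> ?gen" for l
  proof -
    have pos: "word_class (BS_relations m n) [(x, True)] \<in> {BS_a m n, BS_t m n}" for x
      by (cases x) (auto simp: BS_a_def BS_t_def)
    obtain x b where l: "l = (x, b)" by (cases l)
    show ?thesis
      using generate.incl[OF pos[of x], of "BS m n"] generate.inv[OF pos[of x], of "BS m n"]
      by (cases b) (auto simp: l inv_BS_letter)
  qed
  have "word_class (BS_relations m n) w \<in> ?gen" for w
  proof (induction w)
    case Nil
    show ?case using generate.one[of "BS m n"] by (simp add: one_BS)
  next
    case (Cons l w)
    show ?case using generate.eng[OF letter[of l] Cons] by (simp add: mult_BS)
  qed
  then show "carrier (BS m n) \<subseteq> ?gen" by (auto simp: carrier_BS)
qed

lemma BS_relation: "BS_t 1 N \<otimes>\<^bsub>BS 1 N\<^esub> BS_a 1 N \<otimes>\<^bsub>BS 1 N\<^esub> inv\<^bsub>BS 1 N\<^esub> BS_t 1 N = BS_a 1 N [^]\<^bsub>BS 1 N\<^esub> N"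
proof -
  interpret group "BS 1 N" by (rule group_BS)
  let ?R = "BS_relations 1 N"
  have nat_pow: "word_class ?R (replicate k l) = word_class ?R [l] [^]\<^bsub>BS 1 N\<^esub> k" for k l
  proof (induction k)
    case (Suc k)
    have "word_class ?R (replicate (Suc k) l) = word_class ?R (replicate k l) \<otimes>\<^bsub>BS 1 N\<^esub> word_class ?R [l]"
      by (simp add: mult_BS replicate_append_same)
    then show ?case by (simp add: Suc)
  qed (simp add: one_BS)
  have "word_class ?R ([(gen_t, True)] @ gen_pow gen_a 1 @ [(gen_t, False)]) = word_class ?R (gen_pow gen_a N)"
    unfolding word_class_eq_iff
    using pres_eq.relation[of "[(gen_t, True)] @ gen_pow gen_a 1 @ [(gen_t, False)]" "gen_pow gen_a N" ?R "[]" "[]"]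
    by (simp add: BS_relations_def)
  moreover have "word_class ?R (gen_pow gen_a N) = BS_a 1 N [^]\<^bsub>BS 1 N\<^esub> N"
  proof (cases N rule: int_cases2)
    case (nonneg n)
    then have "gen_pow gen_a N = replicate n (gen_a, True)" by (simp add: gen_pow_def)
    moreover have "BS_a 1 N [^]\<^bsub>BS 1 N\<^esub> N = BS_a 1 N [^]\<^bsub>BS 1 N\<^esub> n"
      by (simp only: nonneg int_pow_int)
    ultimately show ?thesis by (simp only: nat_pow BS_a_def)
  next
    case (nonpos n)
    have "BS_a 1 N [^]\<^bsub>BS 1 N\<^esub> N = BS_a 1 N [^]\<^bsub>BS 1 N\<^esub> (- int n)"
      by (rule arg_cong[OF nonpos, of "\<lambda>k. BS_a 1 N [^]\<^bsub>BS 1 N\<^esub> k"])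
    also have "\<dots> = inv\<^bsub>BS 1 N\<^esub> (BS_a 1 N [^]\<^bsub>BS 1 N\<^esub> n)"
      by (rule int_pow_neg_int) (rule BS_generators_closed)
    also have "\<dots> = (inv\<^bsub>BS 1 N\<^esub> BS_a 1 N) [^]\<^bsub>BS 1 N\<^esub> n"
      by (rule nat_pow_inv[symmetric]) (rule BS_generators_closed)
    also have "\<dots> = word_class ?R (replicate n (gen_a, False))"
      using inv_BS_letter[of 1 N gen_a True] by (simp add: nat_pow BS_a_def)
    also have "replicate n (gen_a, False) = gen_pow gen_a N"
      by (cases "n = 0") (simp_all add: gen_pow_def nonpos)
    finally show ?thesis by (rule HOL.sym)
  qed
  ultimately show ?thesis
    using inv_BS_letter[of 1 N gen_t True] by (simp add: BS_t_def BS_a_def mult_BS gen_pow_def)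
qed

text \<open>
  The normal form \<open>t\<^sup>-\<^sup>i a\<^sup>m t\<^sup>j\<close> is sent to \<open>(N\<^sup>-\<^sup>i m, j - i)\<close>, which is trivial only for \<open>m = 0\<close> and
  \<open>i = j\<close>. Hence the kernel is trivial. Injectivity is what allows to compare cardinalities of balls in
  the group with those of balls in the affine model.
\<close>

lemma BS_affine_inj:
  assumes N: "N \<noteq> 0"
  shows "inj_on (BS_affine N) (carrier (BS 1 N))"
proof -
  interpret group "BS 1 N" by (rule group_BS)
  note closed = BS_generators_closed[of 1 N]
  have a: "BS_affine N (BS_a 1 N) = (1, 0)" and t: "BS_affine N (BS_t 1 N) = (0, 1)"
    by (simp_all add: BS_a_def BS_t_def BS_affine_word_class[OF N] word_affine_def affine_mult_def)
  have a_nat: "BS_affine N (BS_a 1 N [^]\<^bsub>BS 1 N\<^esub> k) = (real k, 0)" for k :: nat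
    using closed by (induction k) (simp_all add: BS_affine_one BS_affine_mult N a affine_mult_def)
  have t_nat: "BS_affine N (BS_t 1 N [^]\<^bsub>BS 1 N\<^esub> k) = (0, int k)" for k :: nat
    using closed by (induction k) (simp_all add: BS_affine_one BS_affine_mult N t affine_mult_def)
  have ti_nat: "BS_affine N (inv\<^bsub>BS 1 N\<^esub> BS_t 1 N [^]\<^bsub>BS 1 N\<^esub> k) = (0, - int k)" for k :: nat
    using closed by (simp add: nat_pow_inv BS_affine_inv N t_nat affine_inv_def)
  have a_int: "BS_affine N (BS_a 1 N [^]\<^bsub>BS 1 N\<^esub> k) = (of_int k, 0)" for k :: int
    using closed by (cases k rule: int_cases2)
      (simp_all add: int_pow_int int_pow_neg_int a_nat BS_affine_inv N affine_inv_def)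
  have kernel: "X = \<one>\<^bsub>BS 1 N\<^esub>" if X: "X \<in> carrier (BS 1 N)" "BS_affine N X = (0, 0)" for X
  proof -
    have "X \<in> generate (BS 1 N) {BS_a 1 N, BS_t 1 N}" using X(1) by (simp add: BS_generated)
    then obtain i j :: nat and m :: int where nf:
      "X = inv\<^bsub>BS 1 N\<^esub> BS_t 1 N [^]\<^bsub>BS 1 N\<^esub> i \<otimes>\<^bsub>BS 1 N\<^esub> BS_a 1 N [^]\<^bsub>BS 1 N\<^esub> m \<otimes>\<^bsub>BS 1 N\<^esub> BS_t 1 N [^]\<^bsub>BS 1 N\<^esub> j"
      using ascending_normal_form[OF closed BS_relation] by blast
    have "BS_affine N X = (of_int N powi (- int i) * of_int m, - int i + int j)"
      using closed by (simp add: nf BS_affine_mult N ti_nat a_int t_nat affine_mult_def)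
    then have "m = 0" "i = j" using X(2) N by auto
    then show ?thesis using closed by (simp add: nf nat_pow_inv)
  qed
  show ?thesis
  proof (rule inj_onI)
    fix X Z assume XZ: "X \<in> carrier (BS 1 N)" "Z \<in> carrier (BS 1 N)" "BS_affine N X = BS_affine N Z"
    have "BS_affine N (inv\<^bsub>BS 1 N\<^esub> X \<otimes>\<^bsub>BS 1 N\<^esub> Z) = BS_affine N (inv\<^bsub>BS 1 N\<^esub> X \<otimes>\<^bsub>BS 1 N\<^esub> X)"
      by (simp only: BS_affine_mult[OF N inv_closed[OF XZ(1)] XZ(1)]
          BS_affine_mult[OF N inv_closed[OF XZ(1)] XZ(2)] XZ(3))
    also have "\<dots> = (0, 0)" using XZ by (simp add: BS_affine_one N)
    finally have "inv\<^bsub>BS 1 N\<^esub> X \<otimes>\<^bsub>BS 1 N\<^esub> Z = \<one>\<^bsub>BS 1 N\<^esub>"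
      using XZ by (intro kernel) auto
    then show "X = Z" using XZ inv_equality inv_inv by (metis inv_closed)
  qed
qed

section \<open>Word balls and the normal closure\<close>

lemma (in group) foldr_mult_closed: "set w \<subseteq> carrier G \<Longrightarrow> foldr (\<otimes>) w \<one> \<in> carrier G"
  by (induction w) auto

lemma (in group) foldr_mult_append:
  "set v \<subseteq> carrier G \<Longrightarrow> set w \<subseteq> carrier G \<Longrightarrow>
    foldr (\<otimes>) (v @ w) \<one> = foldr (\<otimes>) v \<one> \<otimes> foldr (\<otimes>) w \<one>"
  by (induction v) (auto simp: foldr_mult_closed m_assoc)

text \<open>
  The ball is defined by means of a least length. As \<open>Y\<close> generates the group, every element is the value
  of some word, so the least length is attained.
\<close>

lemma (in group) word_ball_eq_words:
  assumes "finite_generating_set G Y"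
  shows "word_ball G Y n = (\<lambda>w. foldr (\<otimes>) w \<one>) ` {w. set w \<subseteq> Y \<union> m_inv G ` Y \<and> length w \<le> n}"
proof -
  have Y: "Y \<subseteq> carrier G" "generate G Y = carrier G"
    using assms by (auto simp: finite_generating_set_def)
  let ?Y = "Y \<union> m_inv G ` Y"
  have Y': "?Y \<subseteq> carrier G" using Y(1) by auto
  have ex: "\<exists>w. set w \<subseteq> ?Y \<and> foldr (\<otimes>) w \<one> = g" if "g \<in> carrier G" for g
  proof -
    have "g \<in> generate G Y" using that Y(2) by simp
    then show ?thesis
    proof induction
      case one
      show ?case by (intro exI[of _ "[]"]) simp
    next
      case (incl h)
      then show ?case using Y(1) by (intro exI[of _ "[h]"]) auto
    next
      case (inv h)
      then show ?case using Y(1) by (intro exI[of _ "[inv h]"]) auto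
    next
      case (eng h1 h2)
      then obtain v w where "set v \<subseteq> ?Y" "foldr (\<otimes>) v \<one> = h1" "set w \<subseteq> ?Y" "foldr (\<otimes>) w \<one> = h2"
        by blast
      moreover from this have "foldr (\<otimes>) (v @ w) \<one> = h1 \<otimes> h2"
        using Y' foldr_mult_append[of v w] by auto
      ultimately show ?case by (intro exI[of _ "v @ w"]) auto
    qed
  qed
  have "word_length G Y g \<le> n \<longleftrightarrow> (\<exists>w. set w \<subseteq> ?Y \<and> foldr (\<otimes>) w \<one> = g \<and> length w \<le> n)"
    if "g \<in> carrier G" for g
  proof
    let ?P = "\<lambda>k. \<exists>w. set w \<subseteq> ?Y \<and> foldr (\<otimes>) w \<one> = g \<and> length w = k"
    have "?P (word_length G Y g)"
      unfolding word_length_def by (rule LeastI_ex) (use ex[OF that] in blast)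
    then show "word_length G Y g \<le> n \<Longrightarrow> \<exists>w. set w \<subseteq> ?Y \<and> foldr (\<otimes>) w \<one> = g \<and> length w \<le> n"
      by auto
    assume "\<exists>w. set w \<subseteq> ?Y \<and> foldr (\<otimes>) w \<one> = g \<and> length w \<le> n"
    then obtain k where k: "?P k" "k \<le> n" by blast
    show "word_length G Y g \<le> n"
      unfolding word_length_def by (rule order_trans[OF Least_le[of ?P, OF k(1)] k(2)])
  qed
  then have "word_ball G Y n = {g \<in> carrier G. \<exists>w. set w \<subseteq> ?Y \<and> foldr (\<otimes>) w \<one> = g \<and> length w \<le> n}"
    unfolding word_ball_def by (intro Collect_cong conj_cong HOL.refl)
  also have "\<dots> = (\<lambda>w. foldr (\<otimes>) w \<one>) ` {w. set w \<subseteq> ?Y \<and> length w \<le> n}"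
  proof (intro equalityI subsetI)
    fix g assume "g \<in> (\<lambda>w. foldr (\<otimes>) w \<one>) ` {w. set w \<subseteq> ?Y \<and> length w \<le> n}"
    then obtain w where w: "set w \<subseteq> ?Y" "length w \<le> n" "g = foldr (\<otimes>) w \<one>" by blast
    then have "g \<in> carrier G" using foldr_mult_closed[OF order_trans[OF w(1) Y']] by simp
    then show "g \<in> {g \<in> carrier G. \<exists>w. set w \<subseteq> ?Y \<and> foldr (\<otimes>) w \<one> = g \<and> length w \<le> n}"
      using w by blast
  qed blast
  finally show ?thesis .
qed

lemma BS_affine_word_ball:
  assumes N: "N \<noteq> 0" and Y: "finite_generating_set (BS 1 N) Y"
  shows "BS_affine N ` word_ball (BS 1 N) Y n
    = affine_ball N (BS_affine N ` (Y \<union> m_inv (BS 1 N) ` Y)) n"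
proof -
  interpret group "BS 1 N" by (rule group_BS)
  let ?Y = "Y \<union> m_inv (BS 1 N) ` Y"
  have Y': "?Y \<subseteq> carrier (BS 1 N)" using Y by (auto simp: finite_generating_set_def)
  have eval: "BS_affine N (foldr (mult (BS 1 N)) w \<one>\<^bsub>BS 1 N\<^esub>) = affine_eval N (map (BS_affine N) w)"
    if "set w \<subseteq> ?Y" for w
    using that
  proof (induction w)
    case (Cons y w)
    then have "y \<in> carrier (BS 1 N)" "foldr (mult (BS 1 N)) w \<one>\<^bsub>BS 1 N\<^esub> \<in> carrier (BS 1 N)"
      using Y' foldr_mult_closed[of w] by auto
    then show ?case using Cons by (simp add: BS_affine_mult N)
  qed (simp add: BS_affine_one N)
  have "{w. set w \<subseteq> BS_affine N ` ?Y \<and> length w \<le> n} = map (BS_affine N) ` {w. set w \<subseteq> ?Y \<and> length w \<le> n}"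
  proof (intro equalityI subsetI)
    fix w assume w: "w \<in> {w. set w \<subseteq> BS_affine N ` ?Y \<and> length w \<le> n}"
    then have "w \<in> lists (BS_affine N ` ?Y)" by (simp only: lists_eq_set mem_Collect_eq)
    then have "w \<in> map (BS_affine N) ` lists ?Y" by (simp only: lists_image)
    then show "w \<in> map (BS_affine N) ` {w. set w \<subseteq> ?Y \<and> length w \<le> n}"
      using w by (auto simp: lists_eq_set)
  next
    fix w assume "w \<in> map (BS_affine N) ` {w. set w \<subseteq> ?Y \<and> length w \<le> n}"
    then obtain v where "w = map (BS_affine N) v" "set v \<subseteq> ?Y" "length v \<le> n" by blast
    then show "w \<in> {w. set w \<subseteq> BS_affine N ` ?Y \<and> length w \<le> n}"
      by (simp add: image_mono)
  qed
  then have "affine_ball N (BS_affine N ` ?Y) n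
      = (\<lambda>w. affine_eval N (map (BS_affine N) w)) ` {w. set w \<subseteq> ?Y \<and> length w \<le> n}"
    by (simp only: affine_ball_def image_image)
  also have "\<dots> = BS_affine N ` word_ball (BS 1 N) Y n"
    unfolding word_ball_eq_words[OF Y] image_image by (rule image_cong) (use eval in auto)
  finally show ?thesis ..
qed

text \<open>
  A letter in front of a word multiplies the offset by \<open>1\<close>, \<open>N\<close> or \<open>N\<^sup>-\<^sup>1\<close> and adds an integer, so one
  more factor \<open>N\<close> suffices.
\<close>

lemma word_affine_denominator: "\<exists>c. fst (word_affine N w) * of_int N ^ c \<in> \<int>"
proof (cases "N = 0")
  case False
  show ?thesis
  proof (induction w)
    case Nil
    show ?case by (simp add: word_affine_def)
  next
    case (Cons l w)
    then obtain c where c: "fst (word_affine N w) * of_int N ^ c \<in> \<int>" by blast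
    obtain x b where l: "l = (x, b)" by (cases l)
    have fl: "fst (letter_affine l) \<in> \<int>" by (cases x) (auto simp: l)
    have k: "of_int N powi (snd (letter_affine l)) * of_int N \<in> (\<int> :: real set)"
      using False by (cases x) (auto simp: l power_int_minus)
    have "fst (word_affine N (l # w)) * of_int N ^ Suc c
        = fst (letter_affine l) * of_int N ^ Suc c
          + (of_int N powi (snd (letter_affine l)) * of_int N) * (fst (word_affine N w) * of_int N ^ c)"
      by (simp add: word_affine_def affine_mult_def algebra_simps)
    also have "\<dots> \<in> \<int>"
      by (rule Ints_add[OF Ints_mult[OF fl Ints_power[OF Ints_of_int]] Ints_mult[OF k c]])
    finally show ?case by blast
  qed
qed (intro exI[of _ 1], simp)

lemma affine_generators_BS:
  assumes N: "2 \<le> \<bar>N\<bar>" and Y: "finite_generating_set (BS 1 N) Y"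
  shows "affine_generators N (BS_affine N ` (Y \<union> m_inv (BS 1 N) ` Y))"
proof
  interpret group "BS 1 N" by (rule group_BS)
  let ?Y = "Y \<union> m_inv (BS 1 N) ` Y"
  let ?T = "BS_affine N ` ?Y"
  have N0: "N \<noteq> 0" using N by auto
  have Y': "finite ?Y" "?Y \<subseteq> carrier (BS 1 N)"
    using Y by (auto simp: finite_generating_set_def)
  show "2 \<le> \<bar>N\<bar>" by (fact N)
  show "finite ?T" using Y'(1) by simp
  show "affine_inv N g \<in> ?T" if g: "g \<in> ?T" for g
  proof -
    obtain y where y: "y \<in> ?Y" "g = BS_affine N y" using g by blast
    then have "affine_inv N g = BS_affine N (inv\<^bsub>BS 1 N\<^esub> y)"
      using Y'(2) BS_affine_inv[OF N0] by auto
    moreover have "inv\<^bsub>BS 1 N\<^esub> y \<in> ?Y" using y(1) Y'(2) by auto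
    ultimately show ?thesis by blast
  qed
  have "\<exists>c. fst g * of_int N ^ c \<in> \<int>" if g: "g \<in> ?T" for g
  proof -
    obtain y where y: "y \<in> carrier (BS 1 N)" "g = BS_affine N y" using g Y'(2) by blast
    then obtain w where "y = word_class (BS_relations 1 N) w" by (auto simp: carrier_BS)
    then show ?thesis using word_affine_denominator[of N w] y by (simp add: BS_affine_word_class[OF N0])
  qed
  then obtain c where c: "\<And>g. g \<in> ?T \<Longrightarrow> fst g * of_int N ^ c g \<in> \<int>" by metis
  have "fst g * of_int N ^ (sum c ?T) \<in> \<int>" if "g \<in> ?T" for g
  proof -
    have "c g \<le> sum c ?T" using that Y'(1) by (intro member_le_sum) auto
    then have eq: "fst g * of_int N ^ (sum c ?T) = (fst g * of_int N ^ c g) * of_int N ^ (sum c ?T - c g)"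
      by (simp add: mult.assoc power_add[symmetric])
    show ?thesis
      unfolding eq by (rule Ints_mult[OF c[OF that] Ints_power[OF Ints_of_int]])
  qed
  then show "\<exists>c. \<forall>g\<in>?T. fst g * of_int N ^ c \<in> \<int>" by blast
  have ball: "\<exists>n. BS_affine N X \<in> affine_ball N ?T n" if "X \<in> carrier (BS 1 N)" for X
  proof -
    have "X \<in> word_ball (BS 1 N) Y (word_length (BS 1 N) Y X)" using that by (simp add: word_ball_def)
    then show ?thesis using BS_affine_word_ball[OF N0 Y] by blast
  qed
  show "\<exists>n. (1, 0) \<in> affine_ball N ?T n"
    using ball[OF BS_generators_closed(1)]
    by (simp add: BS_a_def BS_affine_word_class[OF N0] word_affine_def affine_mult_def)
  show "\<exists>n. (0, 1) \<in> affine_ball N ?T n"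
    using ball[OF BS_generators_closed(2)]
    by (simp add: BS_t_def BS_affine_word_class[OF N0] word_affine_def affine_mult_def)
qed

text \<open>
  The elements of height \<open>0\<close> form a normal subgroup that contains \<open>a\<close>, as the kernel of the height.
\<close>

lemma normal_closure_horocyclic_height:
  assumes N: "N \<noteq> 0"
    and X: "X \<in> normal_closure (BS 1 N) (generate (BS 1 N) {BS_a 1 N})"
  shows "snd (BS_affine N X) = 0"
proof -
  interpret group "BS 1 N" by (rule group_BS)
  let ?H = "{X \<in> carrier (BS 1 N). snd (BS_affine N X) = 0}"
  have sub: "subgroup ?H (BS 1 N)"
    by unfold_locales
      (auto simp: BS_affine_one BS_affine_mult BS_affine_inv N affine_mult_def affine_inv_def)
  have "?H \<lhd> BS 1 N"
    unfolding normal_inv_iff using sub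
    by (auto simp: BS_affine_mult BS_affine_inv N affine_mult_def affine_inv_def)
  moreover have "generate (BS 1 N) {BS_a 1 N} \<subseteq> ?H"
    using BS_generators_closed(1)[of 1 N]
    by (intro generate_subgroup_incl[OF _ sub])
      (auto simp: BS_a_def BS_affine_word_class[OF N] word_affine_def affine_mult_def)
  ultimately show ?thesis using X by (auto simp: normal_closure_def)
qed

theorem theorem1p1:
  fixes N :: int and Y :: "bs_gen word set set"
  assumes "\<bar>N\<bar> \<ge> 2"
    and "finite_generating_set (BS 1 N) Y"
  shows "exponentially_negligible (BS 1 N) Y
           (normal_closure (BS 1 N) (generate (BS 1 N) {BS_a 1 N}))"
proof -
  have N0: "N \<noteq> 0" using assms(1) by auto
  let ?A = "normal_closure (BS 1 N) (generate (BS 1 N) {BS_a 1 N})"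
  let ?B = "word_ball (BS 1 N) Y"
  define T where "T = BS_affine N ` (Y \<union> m_inv (BS 1 N) ` Y)"
  interpret affine_generators N T
    unfolding T_def by (rule affine_generators_BS[OF assms])
  have image: "BS_affine N ` ?B n = ball n" for n
    unfolding T_def by (rule BS_affine_word_ball[OF N0 assms(2)])
  have inj: "inj_on (BS_affine N) (?B n)" for n
    using BS_affine_inj[OF N0] by (rule inj_on_subset) (auto simp: word_ball_def)
  have card_B: "card (?B n) = card (ball n)" for n
    using card_image[OF inj, of n] by (simp add: image)
  have card_A: "card (?A \<inter> ?B n) \<le> card {x. (x, 0) \<in> ball n}" for n
  proof (rule card_inj_on_le)
    have height: "BS_affine N X = (fst (BS_affine N X), 0)" if "X \<in> ?A" for X
      using normal_closure_horocyclic_height[OF N0 that] by (simp add: prod_eq_iff)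
    show "inj_on (fst \<circ> BS_affine N) (?A \<inter> ?B n)"
    proof (rule inj_onI)
      fix X Z assume "X \<in> ?A \<inter> ?B n" "Z \<in> ?A \<inter> ?B n" "(fst \<circ> BS_affine N) X = (fst \<circ> BS_affine N) Z"
      then show "X = Z" using height[of X] height[of Z] inj_onD[OF inj[of n], of X Z] by simp
    qed
    show "(fst \<circ> BS_affine N) ` (?A \<inter> ?B n) \<subseteq> {x. (x, 0) \<in> ball n}"
      using height image[of n] by fastforce
    have "{x. (x, 0) \<in> ball n} \<subseteq> fst ` ball n" by force
    then show "finite {x. (x, 0) \<in> ball n}" using finite_ball finite_subset by blast
  qed
  obtain Q \<theta> where Q: "0 < \<theta>" "\<theta> < 1" "0 \<le> Q"
    "\<And>n. real (card {x. (x, 0) \<in> ball n}) \<le> Q * (real n + 1) ^ 3 * \<theta> ^ n * real (card (ball n))"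
    using card_height_zero_le by blast
  have "real (card (?A \<inter> ?B n)) / real (card (?B n)) \<le> Q * (real n + 1) ^ 3 * \<theta> ^ n" for n
  proof -
    have "real (card (?A \<inter> ?B n)) \<le> Q * (real n + 1) ^ 3 * \<theta> ^ n * real (card (?B n))"
      using card_A[of n] Q(4)[of n] unfolding card_B by linarith
    then show ?thesis using card_ball_pos[of n] by (simp add: card_B divide_le_eq)
  qed
  then show ?thesis
    unfolding exponentially_negligible_def by (intro limsup_root_less_one[OF Q(1-3)]) auto
qed

end
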